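(* Let $\mathcal{G}$ be a finite directed graph with condensation graph $\mathcal{C}(\mathcal{G})$, let $\mathcal{N}^e,\mathcal{N}^m\subseteq\mathcal{N}$ be the sets of excited and measured nodes, and let $\mathcal{F}_Z=\{f:\mathbb{R}\to\mathbb{R}\mid f \text{ analytic on } \mathbb{R},\ f(0)=0\}$. Assume that the network is initially at rest, i.e. $y_i^t=0$ for all $t\le 0$ and all nodes $i$. Then the network $\mathcal{G}$ (with the same nonlinearity $f_i=f$ at all nodes) is $f$-$W$-generically locally identifiable in the class $\mathcal{F}_Z$ if and only if at least one node in each source component of $\mathcal{C}(\mathcal{G})$ is excited and at least one node in each sink component of $\mathcal{C}(\mathcal{G})$ is measured.
   Context: **Graph.** $\mathcal{G}=(\mathcal{N},\mathcal{E},W)$ is a finite directed graph (cycles and self-loops allowed) with node set $\mathcal{N}$, edge set $\mathcal{E}\subseteq\mathcal{N}\times\mathcal{N}$ and real weight matrix $W=(w_{ij})$. Convention: $(i,j)\in\mathcal{E}$ is the edge from $j$ to $i$ ($j$ influences $i$). A matrix $W$ is consistent with $\mathcal{E}$ if $w_{ij}\neq 0$ only if $(i,j)\in\mathcal{E}$; such matrices are identified with points of $\mathbb{R}^{|\mathcal{E}|}$. The condensation graph $\mathcal{C}(\mathcal{G})$ has as nodes the strongly connected components of $\mathcal{G}$, with an edge $(C,C')$, $C\ne C'$, whenever there is $(u,w)\in\mathcal{E}$ with $u\in C$, $w\in C'$ (i.e. an edge from $C'$ to $C$). A source component has no incoming edges in $\mathcal{C}(\mathcal{G})$; a sink component has no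 outgoing edges. **Dynamics.** $b_i=1$ if $i\in\mathcal{N}^e$ and $b_i=0$ otherwise; $y_i^t=0$ for $t\le 0$, and for $t\ge 1$ $$y_i^t=f\Big(\sum_j w_{ij}y_j^{t-1}\Big)+b_iu_i^{t-1},$$ where $u_i^s\in\mathbb{R}$ $(s\ge 0)$ are arbitrary excitation signals. For $i\in\mathcal{N}^m$ and $t>0$, $F_i^t$ denotes the function of the past inputs $(u_e^s)_{e\in\mathcal{N}^e,\,0\le s\le t-2}$ such that $y_i^t=b_iu_i^{t-1}+F_i^t$; $\tilde F_i^t$ is the function obtained in the same way from another weight matrix $\tilde W$. **Local identifiability.** The topology $\mathcal{E}$ and $f$ are known, $W$ is unknown. The network is locally identifiable (at $W$, for $f$, with excited nodes $\mathcal{N}^e$ and measured nodes $\mathcal{N}^m$) if there exist $t>0$ and $\epsilon>0$ such that, for every $\tilde W$ consistent with $\mathcal{E}$ with $\|W-\tilde W\|<\epsilon$, the equalities $F_i^t=\tilde F_i^t$ (as functions) for all $i\in\mathcal{N}^m$ imply $W=\tilde W$. **Genericity.** For fixed $f$, the network is $W$-generically locally identifiable if it is locally identifiable at all $W$ consistent with $\mathcal{E}$ except possibly those in a set of zero Lebesgue measure in $\mathbb{R}^{|\mathcal{E}|}$. A property holds for almost all $f\in\mathcal{F}_Z$ ($f$-generically) if there is $M>0$ and a set $Z\subset\mathbb{R}^M$ of zero Lebesgue measure such that the property holds for every $f(x)=\sum_{k\ge1}a_kx^k$ (Maclaurin series) in $\mathcal{F}_Z$ with $(a_1,\dots,a_M)\notin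 Z$. The network is $f$-$W$-generically locally identifiable in $\mathcal{F}_Z$ if it is $W$-generically locally identifiable for almost all $f\in\mathcal{F}_Z$.
   Formalization: It is additionally assumed that every isolated node (no incident edge, not even a self-loop) is both excited and measured; without this the claim fails, e.g. for a single node with no edges that is neither excited nor measured, which is vacuously identifiable. *)

theory Defs
  imports "HOL-Analysis.Analysis" "Graph_Theory.Digraph_Component"
begin

section \<open>The network graph and its condensation\<close>

text \<open>
  The pair \<open>(i, j)\<close> is the edge from \<open>j\<close> to \<open>i\<close>, so the tail of an edge is its
  second component.
\<close>
definition influence_graph :: "'a set \<Rightarrow> ('a \<times> 'a) set \<Rightarrow> ('a, 'a \<times> 'a) pre_digraph" where
  "influence_graph N E = \<lparr>verts = N, arcs = E, tail = snd, head = fst\<rparr>"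

definition condensation :: "'a set \<Rightarrow> ('a \<times> 'a) set \<Rightarrow> ('a set, 'a set \<times> 'a set) pre_digraph" where
  "condensation N E =
     (let S = pre_digraph.sccs_verts (influence_graph N E)
      in influence_graph S
           {(C, C'). C \<in> S \<and> C' \<in> S \<and> C \<noteq> C' \<and> (\<exists>u\<in>C. \<exists>w\<in>C'. (u, w) \<in> E)})"

definition source_component :: "'a set \<Rightarrow> ('a \<times> 'a) set \<Rightarrow> 'a set \<Rightarrow> bool" where
  "source_component N E C \<longleftrightarrow>
     C \<in> verts (condensation N E) \<and> in_arcs (condensation N E) C = {}"

definition sink_component :: "'a set \<Rightarrow> ('a \<times> 'a) set \<Rightarrow> 'a set \<Rightarrow> bool" where
  "sink_component N E C \<longleftrightarrow>
     C \<in> verts (condensation N E) \<and> out_arcs (condensation N E) C = {}"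

text \<open>
  An isolated node without self-loop is a source and a sink component but carries no
  weight, so identifiability cannot force it to be excited or measured. The main
  equivalence therefore needs isolated nodes to be excited and measured, which its
  right-hand side implies anyway.
\<close>
definition isolated_node :: "'a set \<Rightarrow> ('a \<times> 'a) set \<Rightarrow> 'a \<Rightarrow> bool" where
  "isolated_node N E v \<longleftrightarrow>
     v \<in> N \<and> in_arcs (influence_graph N E) v = {} \<and> out_arcs (influence_graph N E) v = {}"

section \<open>Dynamics\<close>

text \<open>
  \<open>node_output N Ne f W u t i\<close> is $y_i^t$. The network is at rest for all times up to
  \<open>0\<close>; no negative time enters the recursion, so time is a natural number.
\<close>
primrec node_output ::
  "'a set \<Rightarrow> 'a set \<Rightarrow> (real \<Rightarrow> real) \<Rightarrow> ('a \<Rightarrow> 'a \<Rightarrow> real) \<Rightarrow> ('a \<Rightarrow> nat \<Rightarrow> real)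
     \<Rightarrow> nat \<Rightarrow> 'a \<Rightarrow> real" where
  "node_output N Ne f W u 0 = (\<lambda>i. 0)"
| "node_output N Ne f W u (Suc t) =
     (\<lambda>i. f (\<Sum>j\<in>N. W i j * node_output N Ne f W u t j) + of_bool (i \<in> Ne) * u i t)"

text \<open>
  For \<open>t > 0\<close> this is $F_i^t$, determined by $y_i^t = b_i u_i^{t-1} + F_i^t$. It is written
  as a function of the complete input signal; by the lemma
  \<open>past_response_past_inputs\<close> below it only depends on the inputs at excited
  nodes up to time \<open>t - 2\<close>.
\<close>
definition past_response ::
  "'a set \<Rightarrow> 'a set \<Rightarrow> (real \<Rightarrow> real) \<Rightarrow> ('a \<Rightarrow> 'a \<Rightarrow> real) \<Rightarrow> nat \<Rightarrow> 'a
     \<Rightarrow> ('a \<Rightarrow> nat \<Rightarrow> real) \<Rightarrow> real" where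
  "past_response N Ne f W t i =
     (\<lambda>u. node_output N Ne f W u t i - of_bool (i \<in> Ne) * u i (t - 1))"

lemma node_output_past_inputs:
  assumes "\<And>e s. e \<in> Ne \<Longrightarrow> s < t \<Longrightarrow> u e s = v e s"
  shows "node_output N Ne f W u t i = node_output N Ne f W v t i"
  using assms by (induction t arbitrary: i) auto

lemma past_response_past_inputs:
  assumes "t > 0" "\<And>e s. e \<in> Ne \<Longrightarrow> s + 2 \<le> t \<Longrightarrow> u e s = v e s"
  shows "past_response N Ne f W t i u = past_response N Ne f W t i v"
proof -
  obtain s where t: "t = Suc s" using assms(1) gr0_implies_Suc by blast
  have "node_output N Ne f W u s j = node_output N Ne f W v s j" for j
    by (rule node_output_past_inputs) (use assms(2) t in auto)
  then show ?thesis by (simp add: past_response_def t)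
qed

section \<open>Local identifiability\<close>

definition consistent :: "('a \<times> 'a) set \<Rightarrow> ('a \<Rightarrow> 'a \<Rightarrow> real) \<Rightarrow> bool" where
  "consistent E W \<longleftrightarrow> (\<forall>i j. W i j \<noteq> 0 \<longrightarrow> (i, j) \<in> E)"

definition matrix_dist :: "'a set \<Rightarrow> ('a \<Rightarrow> 'a \<Rightarrow> real) \<Rightarrow> ('a \<Rightarrow> 'a \<Rightarrow> real) \<Rightarrow> real" where
  "matrix_dist N W W' = L2_set (\<lambda>(i, j). W i j - W' i j) (N \<times> N)"

definition locally_identifiable ::
  "'a set \<Rightarrow> ('a \<times> 'a) set \<Rightarrow> 'a set \<Rightarrow> 'a set \<Rightarrow> (real \<Rightarrow> real) \<Rightarrow> ('a \<Rightarrow> 'a \<Rightarrow> real) \<Rightarrow> bool" where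
  "locally_identifiable N E Ne Nm f W \<longleftrightarrow>
     (\<exists>t>0. \<exists>\<epsilon>>0. \<forall>W'. consistent E W' \<longrightarrow> matrix_dist N W W' < \<epsilon> \<longrightarrow>
        (\<forall>i\<in>Nm. past_response N Ne f W t i = past_response N Ne f W' t i) \<longrightarrow> W = W')"

section \<open>Genericity\<close>

text \<open>
  Lebesgue null sets of $\mathbb{R}^I$ for a finite index set \<open>I\<close>, whose points are the
  functions on \<open>I\<close> that are undefined outside \<open>I\<close>.
\<close>
definition lebesgue_null :: "'i set \<Rightarrow> ('i \<Rightarrow> real) set \<Rightarrow> bool" where
  "lebesgue_null I Z \<longleftrightarrow> Z \<in> null_sets (completion (Pi\<^sub>M I (\<lambda>_. lborel)))"

definition edge_weights :: "('a \<times> 'a) set \<Rightarrow> ('a \<Rightarrow> 'a \<Rightarrow> real) \<Rightarrow> 'a \<times> 'a \<Rightarrow> real" where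
  "edge_weights E W = (\<lambda>(i, j)\<in>E. W i j)"

definition W_generically_locally_identifiable ::
  "'a set \<Rightarrow> ('a \<times> 'a) set \<Rightarrow> 'a set \<Rightarrow> 'a set \<Rightarrow> (real \<Rightarrow> real) \<Rightarrow> bool" where
  "W_generically_locally_identifiable N E Ne Nm f \<longleftrightarrow>
     (\<exists>Z. lebesgue_null E Z \<and>
        (\<forall>W. consistent E W \<longrightarrow> edge_weights E W \<notin> Z \<longrightarrow> locally_identifiable N E Ne Nm f W))"

definition real_analytic :: "(real \<Rightarrow> real) \<Rightarrow> bool" where
  "real_analytic f \<longleftrightarrow> (\<forall>x. \<exists>F. (\<lambda>h. f (x + h)) has_fps_expansion F)"

definition class_FZ :: "(real \<Rightarrow> real) set" where
  "class_FZ = {f. real_analytic f \<and> f 0 = 0}"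

text \<open>
  The Maclaurin series of a member of the class is unique, so quantifying over its
  expansions \<open>A\<close> at \<open>0\<close> only names its coefficients.
\<close>
definition for_almost_all_FZ :: "((real \<Rightarrow> real) \<Rightarrow> bool) \<Rightarrow> bool" where
  "for_almost_all_FZ P \<longleftrightarrow>
     (\<exists>M>0. \<exists>Z. lebesgue_null {1..M::nat} Z \<and>
        (\<forall>f\<in>class_FZ. \<forall>A. f has_fps_expansion A \<longrightarrow> (\<lambda>k\<in>{1..M}. fps_nth A k) \<notin> Z \<longrightarrow> P f))"

definition f_W_generically_locally_identifiable ::
  "'a set \<Rightarrow> ('a \<times> 'a) set \<Rightarrow> 'a set \<Rightarrow> 'a set \<Rightarrow> bool" where
  "f_W_generically_locally_identifiable N E Ne Nm \<longleftrightarrow>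
     for_almost_all_FZ (W_generically_locally_identifiable N E Ne Nm)"

end

(*
  Necessity is elementary: if a source component is not excited, its nodes stay at rest and the
  weights of the edges leaving them have no effect; if a sink component is not measured, the
  weights of the edges entering its nodes have no effect on the measured nodes.

  For sufficiency, excite a single node by a single impulse and expand the responses at the
  measured nodes in powers of its amplitude. The coefficients are polynomials in the weights and
  in finitely many Maclaurin coefficients of f, and the difference of the responses for two weight
  matrices is linear in their difference, with coefficients that are polynomials as well. Local
  identifiability thus follows wherever a certain matrix of polynomials has independent columns.
  By elimination this holds off the zero set of one polynomial, so it is enough to verify it for
  one f and one W. For f(x) = exp x - 1 and distinct weights >= 1 the responses are iterated
  exponentials, whose growth rates are so different that the contribution of every in-neighbour
  can be separated; one then moves backwards from the measured nodes along the edges.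
*)
theory Submission
  imports Defs "HOL-Complex_Analysis.Laurent_Convergence" "HOL-Real_Asymp.Real_Asymp"
begin

section \<open>Real analytic functions\<close>

text \<open>The linearity in the difference of the weight matrices is exact, not of first order:
  telescoping \<open>P ^ k - Q ^ k\<close> writes \<open>A oo P - A oo Q\<close> as
  \<open>P - Q\<close> times a divided difference. The coefficients therefore depend on both weight
  matrices; if the polynomial found by elimination is nonzero where the two coincide, it stays
  nonzero for all \<open>W'\<close> near \<open>W\<close> by continuity, so no inverse function
  argument is involved. Local identifiability fixes a single time \<open>t\<close>, whereas the
  elimination picks rows with various delays. Finitely many rows suffice, and a later impulse shifts
  each delay to one common time. Likewise a polynomial has finitely many variables, which bounds the
  number \<open>M\<close> of Maclaurin coefficients. Equal power series give information near
  amplitude 0, growth rates give information at infinity; the identity theorem on the whole line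
  links the two. For \<open>exp x - 1\<close> the derivative is again an exponential, so directional
  derivatives of responses remain sums of exponentials whose coefficients belong to lower
  levels.\<close>

definition complexify :: "real fps \<Rightarrow> complex fps" where
  "complexify F = Abs_fps (\<lambda>n. complex_of_real (fps_nth F n))"

lemma complexify_nth: "fps_nth (complexify F) n = complex_of_real (fps_nth F n)"
  by (simp add: complexify_def)

lemma complexify_power: "complexify (F ^ k) = complexify F ^ k"
proof (induction k)
  case (Suc k)
  have "complexify (F ^ Suc k) = complexify F * complexify (F ^ k)"
    by (rule fps_ext) (simp add: complexify_nth fps_mult_nth)
  then show ?case using Suc by simp
qed (auto simp: complexify_nth intro!: fps_ext)

lemma complexify_compose: "complexify (F oo G) = complexify F oo complexify G"
  by (rule fps_ext) (simp add: complexify_nth fps_compose_nth flip: complexify_power)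

lemma fps_conv_radius_complexify: "fps_conv_radius (complexify F) = fps_conv_radius F"
  by (simp add: fps_conv_radius_def conv_radius_def complexify_nth)

lemma eval_fps_complexify:
  assumes "norm x < fps_conv_radius F"
  shows "eval_fps (complexify F) (complex_of_real x) = complex_of_real (eval_fps F x)"
proof -
  have "(\<lambda>n. complex_of_real (fps_nth F n * x ^ n)) sums complex_of_real (eval_fps F x)"
    using sums_eval_fps[OF assms] by (rule sums_of_real)
  then show ?thesis by (simp add: eval_fps_def complexify_nth sums_iff)
qed

text \<open>The complexified sums compose to a function with a complex expansion, which gives
  \<open>F oo G\<close> a positive radius of convergence; complexification preserves this radius.
  The values on the real line are then compared through the embedding into the complex
  numbers.\<close>

lemma has_fps_expansion_compose_real:
  fixes f g :: "real \<Rightarrow> real"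
  assumes f: "f has_fps_expansion F" and g: "g has_fps_expansion G" and G0: "fps_nth G 0 = 0"
  shows "(f \<circ> g) has_fps_expansion (F oo G)"
proof -
  have FG: "0 < fps_conv_radius F" "0 < fps_conv_radius G"
    using f g by (auto simp: has_fps_expansion_def)
  have "(eval_fps (complexify F) \<circ> eval_fps (complexify G)) has_fps_expansion (complexify F oo complexify G)"
    using FG G0 by (intro has_fps_expansion_compose eval_fps_has_fps_expansion)
      (auto simp: fps_conv_radius_complexify complexify_nth)
  then have C: "(eval_fps (complexify F) \<circ> eval_fps (complexify G)) has_fps_expansion complexify (F oo G)"
    by (simp add: complexify_compose)
  then have r: "0 < fps_conv_radius (F oo G)"
    by (simp add: has_fps_expansion_def fps_conv_radius_complexify)
  have small: "eventually (\<lambda>x::real. ereal (norm x) < fps_conv_radius H) (nhds 0)"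
    if "0 < fps_conv_radius H" for H :: "real fps"
    using eventually_nhds_in_open[of "eball (0::real) (fps_conv_radius H)" 0] that
    by (simp add: zero_ereal_def dist_norm)
  have g0: "g 0 = 0" and gc: "isCont g 0"
    using g G0 by (auto simp: has_fps_expansion_def eval_fps_at_0 dest: eventually_nhds_x_imp_x
      intro: has_fps_expansion_imp_continuous)
  then have gt: "filterlim g (nhds 0) (nhds 0)"
    using isCont_def tendsto_at_iff_tendsto_nhds by metis
  have "filterlim complex_of_real (nhds (complex_of_real 0)) (nhds 0)"
    by (intro tendsto_of_real filterlim_ident)
  then have ct: "filterlim complex_of_real (nhds 0) (nhds 0)" by simp
  have "eventually (\<lambda>x. eval_fps (F oo G) x = f (g x)) (nhds 0)"
  proof -
    have "eventually (\<lambda>z. eval_fps (complexify (F oo G)) z = eval_fps (complexify F) (eval_fps (complexify G) z)) (nhds 0)"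
      using C by (simp add: has_fps_expansion_def o_def)
    from eventually_compose_filterlim[OF this ct]
    have 1: "eventually (\<lambda>x. eval_fps (complexify (F oo G)) (complex_of_real x) =
        eval_fps (complexify F) (eval_fps (complexify G) (complex_of_real x))) (nhds 0)" .
    have 2: "eventually (\<lambda>x. eval_fps F (g x) = f (g x) \<and> ereal (norm (g x)) < fps_conv_radius F) (nhds 0)"
      using f by (intro eventually_compose_filterlim[OF eventually_conj gt] small FG)
        (auto simp: has_fps_expansion_def)
    have 3: "eventually (\<lambda>x. eval_fps G x = g x) (nhds 0)"
      using g by (auto simp: has_fps_expansion_def)
    show ?thesis using 1 2 3 small[OF r] small[OF FG(2)]
    proof eventually_elim
      case (elim x)
      have "complex_of_real (eval_fps (F oo G) x) = complex_of_real (f (g x))"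
        using elim eval_fps_complexify[of x G] eval_fps_complexify[of "g x" F]
          eval_fps_complexify[of x "F oo G"] by simp
      then show ?case by simp
    qed
  qed
  then show ?thesis using r by (auto simp: has_fps_expansion_def o_def)
qed

text \<open>A nonzero power series has isolated zeros.\<close>

lemma has_fps_expansion_frequently_0:
  fixes g :: "real \<Rightarrow> real"
  assumes g: "g has_fps_expansion G" and z: "frequently (\<lambda>x. g x = 0) (at 0)"
  shows "G = 0"
proof (rule ccontr)
  assume "G \<noteq> 0"
  then obtain m where m: "fps_nth G m \<noteq> 0" by (auto simp: fps_eq_iff)
  have "0 < fps_conv_radius G" using g by (simp add: has_fps_expansion_def)
  then obtain r where r: "0 < r" "ereal r < fps_conv_radius G"
    using ereal_dense2 by (metis ereal_less(2))
  have ev: "eventually (\<lambda>x. eval_fps G x = g x) (at 0)"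
    using g by (auto simp: has_fps_expansion_def eventually_at_filter elim: eventually_mono)
  have fr: "frequently (\<lambda>x. eval_fps G x = 0) (at 0)"
    using frequently_eventually_frequently[OF z ev] by (rule frequently_elim1) auto
  have cont: "isCont (eval_fps G) 0"
    using \<open>0 < fps_conv_radius G\<close> by (intro continuous_eval_fps) (simp add: zero_ereal_def)
  \<comment> \<open>The result on isolated zeros invoked below expects the value 0 at the centre and
    a nonzero coefficient of positive index; continuity and the accumulating zeros provide the
    first, hence also the second.\<close>
  have e0: "eval_fps G 0 = 0"
  proof (rule ccontr)
    assume "eval_fps G 0 \<noteq> 0"
    then have "eventually (\<lambda>x. eval_fps G x \<noteq> 0) (at 0)"
      using cont by (simp add: isCont_def tendsto_imp_eventually_ne)
    with fr show False by (simp add: frequently_def)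
  qed
  then have "m > 0" using m eval_fps_at_0[of G] by (cases m) auto
  have "(\<lambda>n. fps_nth G n * (x - 0) ^ n) sums eval_fps G x" if "norm (x - 0) < r" for x
    using sums_eval_fps[of x G] that r by (simp add: order.strict_trans[of "ereal \<bar>x\<bar>" "ereal r"])
  from powser_0_nonzero[OF r(1) this e0 m \<open>m > 0\<close>]
  obtain s where s: "0 < s" "\<And>x. x \<in> cball 0 s - {0} \<Longrightarrow> eval_fps G x \<noteq> 0" by blast
  have "eventually (\<lambda>x. eval_fps G x \<noteq> 0) (at 0)"
    unfolding eventually_at using s by (intro exI[of _ s]) auto
  with fr show False by (simp add: frequently_def)
qed

lemma has_fps_expansion_unique_real:
  fixes g :: "real \<Rightarrow> real"
  assumes "g has_fps_expansion F" "g has_fps_expansion G"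
  shows "F = G"
proof -
  have "(\<lambda>x. g x - g x) has_fps_expansion (F - G)"
    using assms by (intro has_fps_expansion_diff)
  then have "F - G = 0"
    by (rule has_fps_expansion_frequently_0) (simp add: frequently_def)
  then show ?thesis by simp
qed

section \<open>Closure properties of real analytic functions and the identity theorem on the
  line\<close>

lemma real_analytic_const: "real_analytic (\<lambda>_. c)"
  by (auto simp: real_analytic_def)

lemma real_analytic_id: "real_analytic (\<lambda>x. x)"
  unfolding real_analytic_def
proof
  show "\<exists>F. (\<lambda>h. x + h) has_fps_expansion F" for x :: real
    using has_fps_expansion_add[OF has_fps_expansion_const has_fps_expansion_fps_X] by blast
qed

lemma real_analytic_add: "real_analytic f \<Longrightarrow> real_analytic g \<Longrightarrow> real_analytic (\<lambda>x. f x + g x)"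
  unfolding real_analytic_def using has_fps_expansion_add[of "\<lambda>h. f (_ + h)" _ "\<lambda>h. g (_ + h)"] by blast

lemma real_analytic_mult: "real_analytic f \<Longrightarrow> real_analytic g \<Longrightarrow> real_analytic (\<lambda>x. f x * g x)"
  unfolding real_analytic_def using has_fps_expansion_mult[of "\<lambda>h. f (_ + h)" _ "\<lambda>h. g (_ + h)"] by blast

lemma real_analytic_diff: "real_analytic f \<Longrightarrow> real_analytic g \<Longrightarrow> real_analytic (\<lambda>x. f x - g x)"
  unfolding real_analytic_def using has_fps_expansion_diff[of "\<lambda>h. f (_ + h)" _ "\<lambda>h. g (_ + h)"] by blast

lemma real_analytic_sum:
  "(\<And>a. a \<in> A \<Longrightarrow> real_analytic (f a)) \<Longrightarrow> real_analytic (\<lambda>x. \<Sum>a\<in>A. f a x)"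
  by (induction A rule: infinite_finite_induct) (auto intro: real_analytic_const real_analytic_add)

lemma real_analytic_exp:
  assumes "real_analytic f" shows "real_analytic (\<lambda>x. exp (f x))"
  unfolding real_analytic_def
proof
  fix x
  obtain F where F: "(\<lambda>h. f (x + h)) has_fps_expansion F"
    using assms by (auto simp: real_analytic_def)
  \<comment> \<open>Composition needs an inner series without constant term, so \<open>f x\<close>
    is subtracted here and restored as the factor \<open>exp (f x)\<close>.\<close>
  then have "(\<lambda>h. f (x + h) - f x) has_fps_expansion (F - fps_const (f x))"
    by (intro has_fps_expansion_diff) auto
  moreover have "fps_nth (F - fps_const (f x)) 0 = 0"
    using F by (auto simp: has_fps_expansion_def eval_fps_at_0 dest!: eventually_nhds_x_imp_x)
  ultimately have "(exp \<circ> (\<lambda>h. f (x + h) - f x)) has_fps_expansion (fps_exp 1 oo (F - fps_const (f x)))"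
    by (intro has_fps_expansion_compose_real has_fps_expansion_exp1)
  then have "(\<lambda>h. exp (f x) * exp (f (x + h) - f x)) has_fps_expansion
      fps_const (exp (f x)) * (fps_exp 1 oo (F - fps_const (f x)))"
    by (intro has_fps_expansion_cmult_left) (simp add: o_def)
  then show "\<exists>G. (\<lambda>h. exp (f (x + h))) has_fps_expansion G"
    by (auto simp flip: exp_add)
qed

lemma real_analytic_poly: "real_analytic (poly p)"
proof (induction p)
  case 0 then show ?case by (simp add: real_analytic_const)
next
  case (pCons a p)
  have "real_analytic (\<lambda>x. a + x * poly p x)"
    by (intro real_analytic_add real_analytic_const real_analytic_mult real_analytic_id pCons.IH)
  then show ?case by (metis (no_types, lifting) poly_pCons ext)
qed

text \<open>The points near which \<open>g\<close> vanishes form an open set; it is closed because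
  zeros accumulating at a point force the expansion there to be 0. Connectedness of the line does
  the rest.\<close>

lemma real_analytic_identity:
  assumes g: "real_analytic g" and z: "eventually (\<lambda>x. g x = 0) (nhds a)"
  shows "g b = 0"
proof -
  define S where "S = {x. eventually (\<lambda>y. g y = 0) (nhds x)}"
  have shift: "eventually P (nhds (x + 0)) \<longleftrightarrow> eventually (\<lambda>h. P (x + h)) (nhds 0)"
    for P and x :: real
    using filtermap_nhds_shift[of "-x" 0] eventually_filtermap[of P "\<lambda>h. h + x" "nhds 0"]
    by (simp add: add.commute)
  have "open S"
    unfolding S_def by (subst open_subopen) (auto simp: eventually_nhds)
  moreover have "closed S"
    unfolding closed_limpt
  proof (intro allI impI)
    fix x assume x: "x islimpt S"
    obtain G where G: "(\<lambda>h. g (x + h)) has_fps_expansion G"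
      using g by (auto simp: real_analytic_def)
    have "frequently (\<lambda>y. y \<in> S) (at x)" using x by (simp add: islimpt_conv_frequently_at)
    then have "frequently (\<lambda>y. g y = 0) (at x)"
      by (rule frequently_elim1) (auto simp: S_def dest: eventually_nhds_x_imp_x)
    then have "frequently (\<lambda>h. g (x + h) = 0) (at 0)"
      by (simp add: at_to_0[of x] frequently_def eventually_filtermap add.commute)
    with G have "G = 0" by (rule has_fps_expansion_frequently_0)
    then have "eventually (\<lambda>h. g (x + h) = 0) (nhds 0)"
      using G by (auto simp: has_fps_expansion_def elim: eventually_mono)
    then show "x \<in> S" using shift[of "\<lambda>y. g y = 0" x] by (simp add: S_def)
  qed
  moreover have "a \<in> S" using z by (simp add: S_def)
  ultimately have "S = UNIV" using clopen[of S] by auto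
  then show ?thesis by (auto simp: S_def dest: eventually_nhds_x_imp_x)
qed

section \<open>Polynomial functions on finite products\<close>

text \<open>Polynomials are taken as functions, so evaluation, substitution and limits need no
  formal layer. \<open>I\<close> may be infinite because all Maclaurin coefficients of positive
  index serve as variables.\<close>

inductive_set polyfun :: "'i set \<Rightarrow> (('i \<Rightarrow> real) \<Rightarrow> real) set" for I :: "'i set" where
  const: "(\<lambda>_. c) \<in> polyfun I"
| coord: "i \<in> I \<Longrightarrow> (\<lambda>x. x i) \<in> polyfun I"
| add: "g \<in> polyfun I \<Longrightarrow> h \<in> polyfun I \<Longrightarrow> (\<lambda>x. g x + h x) \<in> polyfun I"
| mult: "g \<in> polyfun I \<Longrightarrow> h \<in> polyfun I \<Longrightarrow> (\<lambda>x. g x * h x) \<in> polyfun I"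

lemma polyfun_diff:
  assumes "g \<in> polyfun I" "h \<in> polyfun I"
  shows "(\<lambda>x. g x - h x) \<in> polyfun I"
  using polyfun.add[OF assms(1) polyfun.mult[OF polyfun.const[of "-1"] assms(2)]] by simp

lemma polyfun_sum:
  assumes "\<And>a. a \<in> A \<Longrightarrow> g a \<in> polyfun I"
  shows "(\<lambda>x. \<Sum>a\<in>A. g a x) \<in> polyfun I"
proof (cases "finite A")
  case True
  then show ?thesis using assms
    by (induction A rule: finite_induct) (auto intro: polyfun.intros)
qed (auto intro: polyfun.intros)

lemma polyfun_mono: "g \<in> polyfun I \<Longrightarrow> I \<subseteq> J \<Longrightarrow> g \<in> polyfun J"
  by (induction rule: polyfun.induct) (auto intro: polyfun.intros)

text \<open>Source of the number \<open>M\<close> of relevant Maclaurin coefficients: the variables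
  range over an infinite set, but one polynomial sees only finitely many of them.\<close>

lemma polyfun_finite_support:
  assumes "g \<in> polyfun I"
  obtains J where "finite J" "J \<subseteq> I" "g \<in> polyfun J"
proof -
  have "\<exists>J. finite J \<and> J \<subseteq> I \<and> g \<in> polyfun J" using assms
  proof (induction rule: polyfun.induct)
    case (const c) then show ?case by (auto intro!: polyfun.const)
  next
    case (coord i) then show ?case by (intro exI[of _ "{i}"]) (auto intro!: polyfun.coord)
  next
    case (add g h)
    then obtain J K where "finite J" "J \<subseteq> I" "g \<in> polyfun J" "finite K" "K \<subseteq> I" "h \<in> polyfun K"
      by blast
    then show ?case by (intro exI[of _ "J \<union> K"]) (auto intro!: polyfun.add intro: polyfun_mono)
  next
    case (mult g h)
    then obtain J K where "finite J" "J \<subseteq> I" "g \<in> polyfun J" "finite K" "K \<subseteq> I" "h \<in> polyfun K"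
      by blast
    then show ?case by (intro exI[of _ "J \<union> K"]) (auto intro!: polyfun.mult intro: polyfun_mono)
  qed
  then show ?thesis using that by blast
qed

lemma polyfun_subst:
  assumes "g \<in> polyfun I" "\<And>i. i \<in> I \<Longrightarrow> (\<lambda>x. \<phi> x i) \<in> polyfun J"
  shows "(\<lambda>x. g (\<phi> x)) \<in> polyfun J"
  using assms by (induction rule: polyfun.induct) (auto intro: polyfun.intros)

lemma polyfun_cong:
  assumes "g \<in> polyfun I" "\<And>i. i \<in> I \<Longrightarrow> x i = y i"
  shows "g x = g y"
  using assms by (induction rule: polyfun.induct) auto

lemma polyfun_tendsto:
  assumes "g \<in> polyfun I" "\<And>i. i \<in> I \<Longrightarrow> ((\<lambda>s. x s i) \<longlongrightarrow> y i) F"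
  shows "((\<lambda>s. g (x s)) \<longlongrightarrow> g y) F"
  using assms by (induction rule: polyfun.induct) (auto intro!: tendsto_intros)

lemma polyfun_measurable:
  assumes "g \<in> polyfun I"
  shows "g \<in> borel_measurable (Pi\<^sub>M I (\<lambda>_. lborel))"
  using assms by (induction rule: polyfun.induct) auto

lemma polyfun_line_poly:
  assumes "g \<in> polyfun I"
  shows "\<exists>p. \<forall>y. g (x(i := y)) = poly p y"
  using assms
proof (induction rule: polyfun.induct)
  case (const c) then show ?case by (intro exI[of _ "[:c:]"]) auto
next
  case (coord j)
  then show ?case by (intro exI[of _ "if j = i then [:0, 1:] else [:x j:]"]) auto
next
  case (add g h)
  then obtain p q where "\<forall>y. g (x(i := y)) = poly p y" "\<forall>y. h (x(i := y)) = poly q y" by blast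
  then show ?case by (intro exI[of _ "p + q"]) (simp del: fun_upd_apply)
next
  case (mult g h)
  then obtain p q where "\<forall>y. g (x(i := y)) = poly p y" "\<forall>y. h (x(i := y)) = poly q y" by blast
  then show ?case by (intro exI[of _ "p * q"]) (simp del: fun_upd_apply)
qed

section \<open>Zero sets of polynomials and Lebesgue null sets\<close>

interpretation lborel_prod: product_sigma_finite "\<lambda>_::'i. lborel :: real measure"
  by standard

text \<open>Fubini over one variable at a time: freezing coordinate \<open>i\<close> at
  \<open>x0 i\<close> gives a polynomial \<open>h\<close> in the remaining variables with
  \<open>h x0 \<noteq> 0\<close>. Wherever \<open>h\<close> is nonzero, the restriction to the line
  in direction \<open>i\<close> is a nonzero univariate polynomial, which has finitely many
  roots.\<close>

lemma polyfun_zeros_null: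
  assumes "finite I" "g \<in> polyfun I" "g x0 \<noteq> 0"
  shows "{x \<in> space (Pi\<^sub>M I (\<lambda>_. lborel)). g x = 0} \<in> null_sets (Pi\<^sub>M I (\<lambda>_. lborel))"
  using assms
proof (induction I arbitrary: g x0 rule: finite_induct)
  case empty
  then have "g x \<noteq> 0" for x using polyfun_cong[of g "{}" x x0] by auto
  then show ?case by auto
next
  case (insert i I)
  define h where "h = (\<lambda>x. g (x(i := x0 i)))"
  have hI: "h \<in> polyfun I"
  proof -
    have "(\<lambda>x. (x(i := x0 i)) j) \<in> polyfun I" if "j \<in> insert i I" for j
      using that by (cases "j = i") (auto intro: polyfun.intros)
    then show ?thesis unfolding h_def by (rule polyfun_subst[OF insert.prems(1)])
  qed
  have "h x0 \<noteq> 0" using insert.prems by (simp add: h_def)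
  from insert.IH[OF hI this]
  have AE: "AE x in Pi\<^sub>M I (\<lambda>_. lborel). h x \<noteq> 0"
    by (auto simp: eventually_ae_filter)
  let ?Z = "{x \<in> space (Pi\<^sub>M (insert i I) (\<lambda>_. lborel)). g x = 0}"
  let ?M = "Pi\<^sub>M (insert i I) (\<lambda>_. lborel :: real measure)"
  have meas: "?Z \<in> sets ?M"
    using polyfun_measurable[OF insert.prems(1)] by measurable
  have "emeasure ?M ?Z = (\<integral>\<^sup>+ x. indicator ?Z x \<partial>?M)" using meas by simp
  also have "\<dots> = (\<integral>\<^sup>+ x. (\<integral>\<^sup>+ y. indicator ?Z (x(i := y)) \<partial>lborel) \<partial>Pi\<^sub>M I (\<lambda>_. lborel))"
    using meas insert.hyps by (intro lborel_prod.product_nn_integral_insert) auto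
  also have "\<dots> = (\<integral>\<^sup>+ x. 0 \<partial>Pi\<^sub>M I (\<lambda>_. lborel :: real measure))"
  proof (rule nn_integral_cong_AE)
    have inner: "(\<integral>\<^sup>+ y. indicator ?Z (x(i := y)) \<partial>lborel) = 0" if hx: "h x \<noteq> 0" for x
    proof -
      obtain p where p: "\<forall>y. g (x(i := y)) = poly p y"
        using polyfun_line_poly[OF insert.prems(1)] by blast
      then have "p \<noteq> 0" using hx by (auto simp: h_def)
      then have fin: "finite {y. poly p y = 0}" by (rule poly_roots_finite)
      have "(\<integral>\<^sup>+ y. indicator ?Z (x(i := y)) \<partial>lborel) \<le> (\<integral>\<^sup>+ y. indicator {y. poly p y = 0} y \<partial>lborel)"
        using p by (intro nn_integral_mono) (auto simp: indicator_def)
      also have "\<dots> = emeasure lborel {y. poly p y = 0}"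
        using fin by (intro nn_integral_indicator) (auto intro!: borel_closed finite_imp_closed)
      also have "\<dots> = 0" using finite_imp_null_set_lborel[OF fin] by auto
      finally show ?thesis by simp
    qed
    show "AE x in Pi\<^sub>M I (\<lambda>_. lborel). (\<integral>\<^sup>+ y. indicator ?Z (x(i := y)) \<partial>lborel) = 0"
      using AE by eventually_elim (rule inner)
  qed
  finally show ?case using meas by (auto simp: null_sets_def)
qed

lemma polyfun_zeros_lebesgue_null:
  assumes "finite I" "g \<in> polyfun I" "g x0 \<noteq> 0"
  shows "lebesgue_null I {x \<in> extensional I. g x = 0}"
  using null_sets_completionI[OF polyfun_zeros_null[OF assms]]
  by (simp add: lebesgue_null_def space_PiM PiE_def)

text \<open>The unit cube has measure 1, so no null set contains it. This is how a generic property
  yields an actual instance in the necessity part.\<close>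

lemma lebesgue_null_complement:
  assumes "finite I" "lebesgue_null I Z"
  obtains x where "x \<in> extensional I" "x \<notin> Z"
proof -
  let ?M = "Pi\<^sub>M I (\<lambda>_. lborel :: real measure)"
  have "emeasure ?M (Pi\<^sub>E I (\<lambda>_. {0..1})) = (\<Prod>i\<in>I. emeasure lborel {0..1::real})"
    using assms(1) by (intro lborel_prod.emeasure_PiM) auto
  then have "emeasure ?M (Pi\<^sub>E I (\<lambda>_. {0..1})) = 1" by simp
  moreover obtain N' where "N' \<in> null_sets ?M" "Z \<subseteq> N'"
    using assms(2) by (auto simp: lebesgue_null_def null_sets_completion_iff2)
  ultimately have "\<not> Pi\<^sub>E I (\<lambda>_. {0..1}) \<subseteq> Z"
    using emeasure_mono[of "Pi\<^sub>E I (\<lambda>_. {0..1})" N' ?M] by (auto simp: null_sets_def)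
  then obtain x where "x \<in> Pi\<^sub>E I (\<lambda>_. {0..1})" "x \<notin> Z" by blast
  with that show ?thesis by (auto simp: PiE_def)
qed

text \<open>Gaussian elimination: \<open>h e r\<close> is the entry of column \<open>e\<close> in row \<open>r\<close>.\<close>
lemma polyfun_column_rank:
  assumes "finite E" "\<And>e r. e \<in> E \<Longrightarrow> r \<in> R \<Longrightarrow> h e r \<in> polyfun I"
    and "\<And>d. (\<And>r. r \<in> R \<Longrightarrow> (\<Sum>e\<in>E. d e * h e r w0) = 0) \<Longrightarrow> \<forall>e\<in>E. d e = (0::real)"
  shows "\<exists>g\<in>polyfun I. \<exists>R0\<subseteq>R. finite R0 \<and> g w0 \<noteq> 0 \<and>
    (\<forall>w d. g w \<noteq> 0 \<longrightarrow> (\<forall>r\<in>R0. (\<Sum>e\<in>E. d e * h e r w) = 0) \<longrightarrow> (\<forall>e\<in>E. d e = 0))"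
  using assms
proof (induction E arbitrary: h rule: finite_induct)
  case empty
  show ?case by (intro bexI[of _ "\<lambda>_. 1"] exI[of _ "{}"]) (auto intro: polyfun.intros)
next
  case (insert a E)
  have "\<exists>q\<in>R. h a q w0 \<noteq> 0"
  proof (rule ccontr)
    assume H: "\<not> ?thesis"
    have "(\<Sum>e\<in>insert a E. of_bool (e = a) * h e r w0) = 0" if "r \<in> R" for r
      using H that insert.hyps by (auto simp: sum.neutral)
    from insert.prems(2)[OF this] show False by simp
  qed
  then obtain q where q: "q \<in> R" "h a q w0 \<noteq> 0" by blast
  \<comment> \<open>Fraction-free elimination of column \<open>a\<close> with pivot row
    \<open>q\<close>: cross-multiplication keeps the entries polynomial.\<close>
  define h' where "h' = (\<lambda>e r w. h a q w * h e r w - h e q w * h a r w)"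
  have h'poly: "h' e r \<in> polyfun I" if "e \<in> E" "r \<in> R" for e r
    unfolding h'_def using insert.prems(1) that q by (intro polyfun_diff polyfun.mult) auto
  have expand: "(\<Sum>e\<in>E. d e * h' e r w) =
      h a q w * (\<Sum>e\<in>E. d e * h e r w) - h a r w * (\<Sum>e\<in>E. d e * h e q w)" for d r w
    by (simp add: h'_def sum_distrib_left algebra_simps sum_subtractf)
  have ind: "\<forall>e\<in>E. d e = 0" if d: "\<And>r. r \<in> R \<Longrightarrow> (\<Sum>e\<in>E. d e * h' e r w0) = 0" for d :: "_ \<Rightarrow> real"
  proof -
    \<comment> \<open>The value at \<open>a\<close> that makes row \<open>q\<close> vanish; a
      relation among the reduced columns thereby lifts to one among the original columns.\<close>
    define c where "c = - (\<Sum>e\<in>E. d e * h e q w0) / h a q w0"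
    have "(\<Sum>e\<in>insert a E. (d(a := c)) e * h e r w0) = 0" if "r \<in> R" for r
    proof -
      have "(\<Sum>e\<in>insert a E. (d(a := c)) e * h e r w0) = c * h a r w0 + (\<Sum>e\<in>E. (d(a := c)) e * h e r w0)"
        using insert.hyps by simp
      also have "(\<Sum>e\<in>E. (d(a := c)) e * h e r w0) = (\<Sum>e\<in>E. d e * h e r w0)"
        using insert.hyps by (intro sum.cong) auto
      also have "c * h a r w0 + \<dots> = 0"
        using d[OF that] q(2) unfolding expand c_def by (simp add: field_simps)
      finally show ?thesis .
    qed
    from insert.prems(2)[OF this] have "\<forall>e\<in>E. (d(a := c)) e = 0" by blast
    then show ?thesis using insert.hyps by (metis fun_upd_other)
  qed
  obtain g R0 where g: "g \<in> polyfun I" "R0 \<subseteq> R" "finite R0" "g w0 \<noteq> 0"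
    and gd: "\<And>w d. g w \<noteq> 0 \<Longrightarrow> (\<forall>r\<in>R0. (\<Sum>e\<in>E. d e * h' e r w) = 0) \<Longrightarrow> (\<forall>e\<in>E. d e = 0)"
    using insert.IH[of h', OF h'poly ind] by blast
  show ?case
  \<comment> \<open>The first factor forces \<open>d\<close> to vanish on \<open>E\<close>; the
    pivot then gives \<open>d a = 0\<close> from row \<open>q\<close>, which is why \<open>q\<close>
    joins the selected rows.\<close>
  proof (intro bexI[of _ "\<lambda>w. g w * h a q w"] exI[of _ "insert q R0"] conjI allI impI)
    show "(\<lambda>w. g w * h a q w) \<in> polyfun I"
      using g insert.prems(1) q by (intro polyfun.mult) auto
    show "insert q R0 \<subseteq> R" "finite (insert q R0)" "g w0 * h a q w0 \<noteq> 0" using g q by auto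
    fix w d assume nz: "g w * h a q w \<noteq> 0"
      and z: "\<forall>r\<in>insert q R0. (\<Sum>e\<in>insert a E. d e * h e r w) = 0"
    have z': "(\<Sum>e\<in>E. d e * h e r w) = - d a * h a r w" if "r \<in> insert q R0" for r
      using z[rule_format, OF that] insert.hyps by simp
    have "\<forall>r\<in>R0. (\<Sum>e\<in>E. d e * h' e r w) = 0"
      unfolding expand by (simp add: z')
    then have dE: "\<forall>e\<in>E. d e = 0" using gd nz by auto
    moreover have "d a = 0" using z'[of q] dE nz by simp
    ultimately show "\<forall>e\<in>insert a E. d e = 0" by auto
  qed
qed

section \<open>Power series of impulse responses\<close>

text \<open>The quotient of \<open>A oo P - A oo Q\<close> by \<open>P - Q\<close>, written so that
  it also makes sense for \<open>P = Q\<close> and has coefficients polynomial in those of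
  \<open>A\<close>, \<open>P\<close>, \<open>Q\<close>. Cutting off at \<open>Suc n\<close> loses
  nothing for series without constant term, since the inner sum has order at least
  \<open>k - 1\<close>.\<close>

definition fps_divided_diff :: "real fps \<Rightarrow> real fps \<Rightarrow> real fps \<Rightarrow> real fps" where
  "fps_divided_diff A P Q =
     Abs_fps (\<lambda>n. \<Sum>k=1..Suc n. fps_nth A k * fps_nth (\<Sum>i<k. Q ^ (k - Suc i) * P ^ i) n)"

lemma fps_power_mult_power_nth_eq_0:
  fixes P Q :: "real fps"
  assumes "fps_nth P 0 = 0" "fps_nth Q 0 = 0" "n < a + b"
  shows "fps_nth (P ^ a * Q ^ b) n = 0"
  unfolding fps_mult_nth
proof (rule sum.neutral, rule ballI)
  fix j assume "j \<in> {0..n}"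
  then have "j < a \<or> n - j < b" using assms(3) by auto
  then show "fps_nth (P ^ a) j * fps_nth (Q ^ b) (n - j) = 0"
    using startsby_zero_power_prefix assms(1,2) by (metis mult_eq_0_iff)
qed

lemma fps_compose_diff:
  assumes "fps_nth P 0 = 0" "fps_nth Q 0 = 0"
  shows "(A oo P) - (A oo Q) = (P - Q) * fps_divided_diff A P Q"
proof (rule fps_ext)
  fix n
  define S where "S = (\<lambda>k. \<Sum>i<k. Q ^ (k - Suc i) * P ^ i)"
  have S0: "fps_nth (S k) m = 0" if "Suc m < k" for k m
    unfolding S_def fps_sum_nth using that assms
    by (intro sum.neutral ballI fps_power_mult_power_nth_eq_0) auto
  \<comment> \<open>The composition sums \<open>k\<close> up to \<open>n\<close>, the divided
    difference up to \<open>Suc (n - l)\<close>. For \<open>l = 0\<close> the ranges do not nest,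
    but the factor \<open>fps_nth (P - Q) 0\<close> is zero; for \<open>l > 0\<close> the extra
    terms vanish by their order.\<close>
  have inner: "fps_nth (P - Q) l * (\<Sum>k=0..n. fps_nth A k * fps_nth (S k) (n - l)) =
      fps_nth (P - Q) l * (\<Sum>k=1..Suc (n - l). fps_nth A k * fps_nth (S k) (n - l))"
    if "l \<in> {0..n}" for l
  proof (cases "l = 0")
    case False
    have "(\<Sum>k=1..Suc (n - l). fps_nth A k * fps_nth (S k) (n - l)) =
      (\<Sum>k=0..n. fps_nth A k * fps_nth (S k) (n - l))"
    proof (rule sum.mono_neutral_left)
      show "\<forall>k\<in>{0..n} - {1..Suc (n - l)}. fps_nth A k * fps_nth (S k) (n - l) = 0"
      proof
        fix k assume "k \<in> {0..n} - {1..Suc (n - l)}"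
        then have "k = 0 \<or> Suc (n - l) < k" by auto
        then show "fps_nth A k * fps_nth (S k) (n - l) = 0"
          using S0 by (auto simp: S_def)
      qed
    qed (use False that in auto)
    then show ?thesis by simp
  qed (use assms in simp)
  have "fps_nth ((A oo P) - (A oo Q)) n = (\<Sum>k=0..n. fps_nth A k * fps_nth (P ^ k - Q ^ k) n)"
    by (simp add: fps_compose_nth sum_subtractf algebra_simps)
  also have "\<dots> = (\<Sum>k=0..n. fps_nth A k * (\<Sum>l=0..n. fps_nth (P - Q) l * fps_nth (S k) (n - l)))"
    by (simp only: power_diff_sumr2 fps_mult_nth S_def)
  also have "\<dots> = (\<Sum>l=0..n. fps_nth (P - Q) l * (\<Sum>k=0..n. fps_nth A k * fps_nth (S k) (n - l)))"
    unfolding sum_distrib_left by (subst sum.swap) (simp add: mult.left_commute)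
  also have "\<dots> = (\<Sum>l=0..n. fps_nth (P - Q) l * (\<Sum>k=1..Suc (n - l). fps_nth A k * fps_nth (S k) (n - l)))"
    by (rule sum.cong[OF refl inner])
  also have "\<dots> = fps_nth ((P - Q) * fps_divided_diff A P Q) n"
    by (simp add: fps_mult_nth fps_divided_diff_def S_def)
  finally show "fps_nth ((A oo P) - (A oo Q)) n = fps_nth ((P - Q) * fps_divided_diff A P Q) n" .
qed

lemma fps_divided_diff_same: "fps_divided_diff A P P = fps_deriv A oo P"
proof (rule fps_ext)
  fix n
  have S: "(\<Sum>i<k. P ^ (k - Suc i) * P ^ i) = of_nat k * P ^ (k - 1)" for k
  proof -
    have "(\<Sum>i<k. P ^ (k - Suc i) * P ^ i) = (\<Sum>i<k. P ^ (k - 1))"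
      by (intro sum.cong) (auto simp flip: power_add)
    then show ?thesis by simp
  qed
  have "fps_nth (fps_divided_diff A P P) n =
      (\<Sum>k=Suc 0..Suc n. fps_nth A k * (of_nat k * fps_nth (P ^ (k - 1)) n))"
    by (simp add: fps_divided_diff_def S flip: fps_of_nat)
  also have "\<dots> = (\<Sum>k=0..n. fps_nth A (Suc k) * (of_nat (Suc k) * fps_nth (P ^ k) n))"
    by (subst sum.shift_bounds_cl_Suc_ivl) simp
  also have "\<dots> = fps_nth (fps_deriv A oo P) n"
    by (simp add: fps_compose_nth algebra_simps)
  finally show "fps_nth (fps_divided_diff A P P) n = fps_nth (fps_deriv A oo P) n" .
qed

text \<open>
  \<open>impulse_fps N A W e s i\<close> is the output of node \<open>i\<close>, as a power series in the amplitude,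
  \<open>s\<close> steps after an impulse at node \<open>e\<close> has become visible there.
\<close>
primrec impulse_fps :: "'a set \<Rightarrow> real fps \<Rightarrow> ('a \<Rightarrow> 'a \<Rightarrow> real) \<Rightarrow> 'a \<Rightarrow> nat \<Rightarrow> 'a \<Rightarrow> real fps" where
  "impulse_fps N A W e 0 = (\<lambda>i. if i = e then fps_X else 0)"
| "impulse_fps N A W e (Suc s) = (\<lambda>i. A oo (\<Sum>j\<in>N. fps_const (W i j) * impulse_fps N A W e s j))"

definition preact_fps :: "'a set \<Rightarrow> real fps \<Rightarrow> ('a \<Rightarrow> 'a \<Rightarrow> real) \<Rightarrow> 'a \<Rightarrow> nat \<Rightarrow> 'a \<Rightarrow> real fps" where
  "preact_fps N A W e s i = (\<Sum>j\<in>N. fps_const (W i j) * impulse_fps N A W e s j)"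

text \<open>
  The factor of \<open>W' k l - W k l\<close> in the difference of the two impulse responses;
  for \<open>W' = W\<close> it is the partial derivative with respect to the weight of \<open>(k, l)\<close>.
\<close>
primrec sensitivity_fps :: "'a set \<Rightarrow> real fps \<Rightarrow> ('a \<Rightarrow> 'a \<Rightarrow> real) \<Rightarrow> ('a \<Rightarrow> 'a \<Rightarrow> real) \<Rightarrow> 'a \<Rightarrow>
    'a \<times> 'a \<Rightarrow> nat \<Rightarrow> 'a \<Rightarrow> real fps" where
  "sensitivity_fps N A W' W e p 0 = (\<lambda>i. 0)"
| "sensitivity_fps N A W' W e p (Suc s) =
     (\<lambda>i. fps_divided_diff A (preact_fps N A W' e s i) (preact_fps N A W e s i) *
        ((\<Sum>j\<in>N. fps_const (W' i j) * sensitivity_fps N A W' W e p s j) +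
         (if fst p = i then impulse_fps N A W e s (snd p) else 0)))"

section \<open>Exact difference formula for impulse responses\<close>

lemma impulse_fps_nth_0:
  "fps_nth A 0 = 0 \<Longrightarrow> fps_nth (impulse_fps N A W e s i) 0 = 0"
  by (cases s) (auto simp: fps_compose_nth)

lemma preact_fps_nth_0:
  "fps_nth A 0 = 0 \<Longrightarrow> fps_nth (preact_fps N A W e s i) 0 = 0"
  by (auto simp: preact_fps_def fps_sum_nth impulse_fps_nth_0)

lemma sum_over_edges_into:
  fixes g :: "'a \<times> 'a \<Rightarrow> 'b::comm_monoid_add"
  assumes "finite N" "E \<subseteq> N \<times> N" "\<And>p. p \<notin> E \<Longrightarrow> g p = 0"
  shows "(\<Sum>p\<in>E. if fst p = i then g p else 0) = (\<Sum>j\<in>N. g (i, j))"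
proof -
  have fE: "finite E" using assms(1,2) by (meson finite_SigmaI finite_subset)
  have "(\<Sum>p\<in>E. if fst p = i then g p else 0) = (\<Sum>p\<in>Pair i ` N. g p)"
    using assms fE by (intro sum.mono_neutral_cong) auto
  also have "\<dots> = (\<Sum>j\<in>N. g (i, j))"
    by (subst sum.reindex) (auto intro: inj_onI)
  finally show ?thesis .
qed

text \<open>The recursion for sensitivities is linear, so it passes to combinations over the edges.
  It is applied with \<open>d\<close> the difference of two weight matrices, and with
  \<open>W' = W\<close> and an arbitrary direction \<open>d\<close>.\<close>

lemma sum_sensitivity_fps_Suc:
  assumes "finite N" "E \<subseteq> N \<times> N" "\<And>p. p \<notin> E \<Longrightarrow> d p = 0"
  shows "(\<Sum>p\<in>E. fps_const (d p) * sensitivity_fps N A W' W e p (Suc s) i) =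
    fps_divided_diff A (preact_fps N A W' e s i) (preact_fps N A W e s i) *
     (\<Sum>j\<in>N. fps_const (W' i j) * (\<Sum>p\<in>E. fps_const (d p) * sensitivity_fps N A W' W e p s j)
       + fps_const (d (i, j)) * impulse_fps N A W e s j)" (is "?L = ?D * ?R")
proof -
  have "?L = ?D * (\<Sum>p\<in>E. (\<Sum>j\<in>N. fps_const (d p) * (fps_const (W' i j) * sensitivity_fps N A W' W e p s j)) +
         (if fst p = i then fps_const (d p) * impulse_fps N A W e s (snd p) else 0))"
    unfolding sum_distrib_left
    by (rule sum.cong) (auto simp: algebra_simps sum_distrib_left)
  also have "(\<Sum>p\<in>E. (\<Sum>j\<in>N. fps_const (d p) * (fps_const (W' i j) * sensitivity_fps N A W' W e p s j)) +
         (if fst p = i then fps_const (d p) * impulse_fps N A W e s (snd p) else 0)) = ?R"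
  proof -
    have "(\<Sum>p\<in>E. if fst p = i then fps_const (d p) * impulse_fps N A W e s (snd p) else 0)
        = (\<Sum>j\<in>N. fps_const (d (i, j)) * impulse_fps N A W e s j)"
      using sum_over_edges_into[OF assms(1,2), of "\<lambda>p. fps_const (d p) * impulse_fps N A W e s (snd p)" i]
        assms(3) by simp
    moreover have "(\<Sum>p\<in>E. \<Sum>j\<in>N. fps_const (d p) * (fps_const (W' i j) * sensitivity_fps N A W' W e p s j))
        = (\<Sum>j\<in>N. fps_const (W' i j) * (\<Sum>p\<in>E. fps_const (d p) * sensitivity_fps N A W' W e p s j))"
      unfolding sum_distrib_left by (subst sum.swap) (simp add: mult.left_commute)
    ultimately show ?thesis by (simp add: sum.distrib)
  qed
  finally show ?thesis .
qed

lemma impulse_fps_diff: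
  assumes "finite N" "E \<subseteq> N \<times> N" "consistent E W" "consistent E W'" "fps_nth A 0 = 0"
  shows "impulse_fps N A W' e s i - impulse_fps N A W e s i =
    (\<Sum>p\<in>E. fps_const (W' (fst p) (snd p) - W (fst p) (snd p)) * sensitivity_fps N A W' W e p s i)"
proof (induction s arbitrary: i)
  case 0 then show ?case by simp
next
  case (Suc s)
  let ?d = "\<lambda>p. W' (fst p) (snd p) - W (fst p) (snd p)"
  have d: "?d p = 0" if "p \<notin> E" for p
    using assms(3,4) that by (metis consistent_def diff_self prod.collapse)
  have "impulse_fps N A W' e (Suc s) i - impulse_fps N A W e (Suc s) i =
      fps_divided_diff A (preact_fps N A W' e s i) (preact_fps N A W e s i) *
      (preact_fps N A W' e s i - preact_fps N A W e s i)"
    using fps_compose_diff[of "preact_fps N A W' e s i" "preact_fps N A W e s i" A] assms(5)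
    by (simp add: preact_fps_nth_0) (simp add: preact_fps_def mult.commute)
  \<comment> \<open>Splitting W'y' - Wy as W'(y' - y) + (W' - W)y is what makes the sensitivities
    carry the weights \<open>W'\<close> but the responses of \<open>W\<close>.\<close>
  also have "preact_fps N A W' e s i - preact_fps N A W e s i =
     (\<Sum>j\<in>N. fps_const (W' i j) * (impulse_fps N A W' e s j - impulse_fps N A W e s j)
       + fps_const (?d (i, j)) * impulse_fps N A W e s j)"
    unfolding preact_fps_def sum_subtractf[symmetric]
    by (rule sum.cong) (auto simp: algebra_simps simp flip: fps_const_sub)
  also have "fps_divided_diff A (preact_fps N A W' e s i) (preact_fps N A W e s i) * \<dots> =
      (\<Sum>p\<in>E. fps_const (?d p) * sensitivity_fps N A W' W e p (Suc s) i)"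
    unfolding Suc.IH
    by (rule sum_sensitivity_fps_Suc[where d = ?d, symmetric, OF assms(1,2)]) (rule d)
  finally show ?case .
qed

section \<open>Network outputs under a delayed impulse\<close>

definition impulse :: "'a \<Rightarrow> nat \<Rightarrow> real \<Rightarrow> 'a \<Rightarrow> nat \<Rightarrow> real" where
  "impulse e r x = (\<lambda>i s. if i = e \<and> s = r then x else 0)"

lemma impulse_apply: "impulse e r x i s = (if i = e \<and> s = r then x else 0)"
  by (simp add: impulse_def)

lemma node_output_before_impulse:
  assumes "f 0 = 0" "t \<le> r"
  shows "node_output N Ne f W (impulse e r x) t i = 0"
  using assms(2)
proof (induction t arbitrary: i)
  case (Suc t) then show ?case using assms(1) by (simp add: impulse_def)
qed simp

text \<open>The network is at rest up to time \<open>r\<close>, so the delay \<open>r\<close> leaves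
  the series unchanged, and an input given at time \<open>r\<close> is visible at
  \<open>Suc r\<close>. Keeping \<open>r + s\<close> fixed makes the responses for all
  \<open>s\<close> up to that sum observable at one time.\<close>

lemma node_output_impulse_expansion:
  assumes "f has_fps_expansion A" "f 0 = 0" "e \<in> Ne"
  shows "(\<lambda>x. node_output N Ne f W (impulse e r x) (Suc (r + s)) i) has_fps_expansion
    impulse_fps N A W e s i"
proof (induction s arbitrary: i)
  case 0
  have "(\<lambda>x. node_output N Ne f W (impulse e r x) (Suc (r + 0)) i) = (\<lambda>x. if i = e then x else 0)"
    using assms by (auto simp: node_output_before_impulse impulse_apply)
  then show ?case by (auto intro: has_fps_expansion_fps_X)
next
  case (Suc s)
  have A0: "fps_nth A 0 = 0"
    using assms(1,2) by (auto simp: has_fps_expansion_def eval_fps_at_0 dest: eventually_nhds_x_imp_x)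
  have pre: "(\<lambda>x. \<Sum>j\<in>N. W i j * node_output N Ne f W (impulse e r x) (Suc (r + s)) j)
     has_fps_expansion preact_fps N A W e s i"
    unfolding preact_fps_def
    by (intro has_fps_expansion_sum has_fps_expansion_cmult_left Suc.IH)
  have "(\<lambda>x. node_output N Ne f W (impulse e r x) (Suc (r + Suc s)) i) =
     f \<circ> (\<lambda>x. \<Sum>j\<in>N. W i j * node_output N Ne f W (impulse e r x) (Suc (r + s)) j)"
    by (auto simp: impulse_apply simp del: node_output.simps(1))
  then show ?case
    using has_fps_expansion_compose_real[OF assms(1) pre preact_fps_nth_0[OF A0]]
    by (simp add: preact_fps_def)
qed

section \<open>Polynomial dependence of the series on the parameters\<close>

definition polyfun_fps :: "'i set \<Rightarrow> (('i \<Rightarrow> real) \<Rightarrow> real fps) \<Rightarrow> bool" where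
  "polyfun_fps I F \<longleftrightarrow> (\<forall>n. (\<lambda>w. fps_nth (F w) n) \<in> polyfun I)"

lemma polyfun_fps_const: "polyfun_fps I (\<lambda>_. F)"
  by (simp add: polyfun_fps_def polyfun.const)

lemma polyfun_fps_fps_const: "g \<in> polyfun I \<Longrightarrow> polyfun_fps I (\<lambda>w. fps_const (g w))"
  unfolding polyfun_fps_def
proof
  fix n assume "g \<in> polyfun I"
  then show "(\<lambda>w. fps_nth (fps_const (g w)) n) \<in> polyfun I"
    by (cases "n = 0") (auto intro: polyfun.const)
qed

lemma polyfun_fps_add: "polyfun_fps I F \<Longrightarrow> polyfun_fps I G \<Longrightarrow> polyfun_fps I (\<lambda>w. F w + G w)"
  by (auto simp: polyfun_fps_def intro: polyfun.add)

lemma polyfun_fps_sum: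
  "(\<And>a. a \<in> S \<Longrightarrow> polyfun_fps I (F a)) \<Longrightarrow> polyfun_fps I (\<lambda>w. \<Sum>a\<in>S. F a w)"
  by (auto simp: polyfun_fps_def fps_sum_nth intro!: polyfun_sum)

lemma polyfun_fps_mult: "polyfun_fps I F \<Longrightarrow> polyfun_fps I G \<Longrightarrow> polyfun_fps I (\<lambda>w. F w * G w)"
  by (auto simp: polyfun_fps_def fps_mult_nth intro!: polyfun_sum polyfun.mult)

lemma polyfun_fps_power: "polyfun_fps I F \<Longrightarrow> polyfun_fps I (\<lambda>w. F w ^ n)"
  by (induction n) (auto intro: polyfun_fps_mult polyfun_fps_const)

lemma polyfun_fps_compose:
  assumes "polyfun_fps I A" "polyfun_fps I F" shows "polyfun_fps I (\<lambda>w. A w oo F w)"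
  using assms(1) polyfun_fps_power[OF assms(2)]
  by (auto simp: polyfun_fps_def fps_compose_nth intro!: polyfun_sum polyfun.mult)

lemma polyfun_fps_divided_diff:
  assumes "polyfun_fps I A" "polyfun_fps I F" "polyfun_fps I G"
  shows "polyfun_fps I (\<lambda>w. fps_divided_diff (A w) (F w) (G w))"
proof -
  have "polyfun_fps I (\<lambda>w. \<Sum>i<k. G w ^ (k - Suc i) * F w ^ i)" for k
    using assms by (intro polyfun_fps_sum polyfun_fps_mult polyfun_fps_power)
  then show ?thesis using assms(1) unfolding polyfun_fps_def fps_divided_diff_def fps_nth_Abs_fps
    by (intro allI polyfun_sum polyfun.mult) auto
qed

definition weight_matrix :: "('a \<times> 'a) set \<Rightarrow> ('a \<times> 'a \<Rightarrow> real) \<Rightarrow> 'a \<Rightarrow> 'a \<Rightarrow> real" where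
  "weight_matrix E v = (\<lambda>i j. if (i, j) \<in> E then v (i, j) else 0)"

definition fps_of_coeffs :: "(nat \<Rightarrow> real) \<Rightarrow> real fps" where
  "fps_of_coeffs a = Abs_fps (\<lambda>k. if k = 0 then 0 else a k)"

lemma polyfun_fps_impulse:
  assumes "polyfun_fps I A" "\<And>i j. (\<lambda>w. W w i j) \<in> polyfun I"
  shows "polyfun_fps I (\<lambda>w. impulse_fps N (A w) (W w) e s i)"
proof (induction s arbitrary: i)
  case 0 then show ?case by (auto intro: polyfun_fps_const)
next
  case (Suc s)
  then show ?case using assms
    by (auto intro!: polyfun_fps_compose polyfun_fps_sum polyfun_fps_mult polyfun_fps_fps_const)
qed

lemma polyfun_fps_preact:
  assumes "polyfun_fps I A" "\<And>i j. (\<lambda>w. W w i j) \<in> polyfun I"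
  shows "polyfun_fps I (\<lambda>w. preact_fps N (A w) (W w) e s i)"
  unfolding preact_fps_def using assms
  by (intro polyfun_fps_sum polyfun_fps_mult polyfun_fps_fps_const polyfun_fps_impulse)

lemma polyfun_fps_sensitivity:
  assumes "polyfun_fps I A" "\<And>i j. (\<lambda>w. W w i j) \<in> polyfun I" "\<And>i j. (\<lambda>w. W' w i j) \<in> polyfun I"
  shows "polyfun_fps I (\<lambda>w. sensitivity_fps N (A w) (W' w) (W w) e p s i)"
proof (induction s arbitrary: i)
  case 0 then show ?case by (auto intro: polyfun_fps_const)
next
  case (Suc s)
  have "polyfun_fps I (\<lambda>w. if fst p = i then impulse_fps N (A w) (W w) e s (snd p) else 0)"
    by (cases "fst p = i") (simp_all add: assms(1,2) polyfun_fps_const polyfun_fps_impulse)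
  then show ?case using Suc assms
    by (auto intro!: polyfun_fps_add polyfun_fps_divided_diff polyfun_fps_sum polyfun_fps_mult polyfun_fps_fps_const
        polyfun_fps_preact)
qed

section \<open>Iterated exponentials\<close>

text \<open>The gap in the exponents must beat every multiple of \<open>\<beta>\<close>, so that the
  quotient of the exponentials beats every tempered factor.\<close>

definition dominates :: "(real \<Rightarrow> real) \<Rightarrow> (real \<Rightarrow> real) \<Rightarrow> (real \<Rightarrow> real) \<Rightarrow> bool" where
  "dominates \<beta> f g \<longleftrightarrow> (\<forall>K. eventually (\<lambda>v. K * \<beta> v \<le> f v - g v) at_top)"

lemma dominates_trans:
  assumes "dominates \<beta> f g" "dominates \<beta> g h" shows "dominates \<beta> f h"
  unfolding dominates_def
proof
  fix K
  have "eventually (\<lambda>v. K * \<beta> v \<le> f v - g v) at_top" "eventually (\<lambda>v. 0 * \<beta> v \<le> g v - h v) at_top"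
    using assms unfolding dominates_def by blast+
  then show "eventually (\<lambda>v. K * \<beta> v \<le> f v - h v) at_top"
    by eventually_elim simp
qed

lemma dominates_max:
  assumes "finite I" "I \<noteq> {}"
    and "\<And>i j. i \<in> I \<Longrightarrow> j \<in> I \<Longrightarrow> i \<noteq> j \<Longrightarrow> dominates \<beta> (z i) (z j) \<or> dominates \<beta> (z j) (z i)"
  shows "\<exists>k\<in>I. \<forall>j\<in>I - {k}. dominates \<beta> (z k) (z j)"
  using assms
proof (induction I rule: finite_ne_induct)
  case (insert i I)
  then obtain k where k: "k \<in> I" "\<forall>j\<in>I - {k}. dominates \<beta> (z k) (z j)" by blast
  have "i \<noteq> k" using insert.hyps k by auto
  then have "dominates \<beta> (z i) (z k) \<or> dominates \<beta> (z k) (z i)"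
    using insert.prems[of i k] k by auto
  then show ?case
  proof
    assume ik: "dominates \<beta> (z i) (z k)"
    then have "\<forall>j\<in>I. dominates \<beta> (z i) (z j)" using k dominates_trans[OF ik] by blast
    then show ?thesis by blast
  qed (use k in blast)
qed simp

definition tempered :: "(real \<Rightarrow> real) \<Rightarrow> (real \<Rightarrow> real) \<Rightarrow> bool" where
  "tempered \<beta> g \<longleftrightarrow> (\<exists>K\<ge>0. eventually (\<lambda>v. exp (- K * \<beta> v) \<le> \<bar>g v\<bar> \<and> \<bar>g v\<bar> \<le> exp (K * \<beta> v)) at_top)"

lemma temperedE:
  assumes "tempered \<beta> g"
  obtains K where "K \<ge> 0" "eventually (\<lambda>v. exp (- K * \<beta> v) \<le> \<bar>g v\<bar>) at_top"
    "eventually (\<lambda>v. \<bar>g v\<bar> \<le> exp (K * \<beta> v)) at_top"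
  using assms unfolding tempered_def eventually_conj_iff by blast

lemma tempered_const:
  assumes "c \<noteq> 0" "eventually (\<lambda>v. 1 \<le> \<beta> v) at_top"
  shows "tempered \<beta> (\<lambda>_. c)"
  unfolding tempered_def
proof (intro exI[of _ "\<bar>ln \<bar>c\<bar>\<bar>"] conjI)
  show "eventually (\<lambda>v. exp (- \<bar>ln \<bar>c\<bar>\<bar> * \<beta> v) \<le> \<bar>c\<bar> \<and> \<bar>c\<bar> \<le> exp (\<bar>ln \<bar>c\<bar>\<bar> * \<beta> v)) at_top"
    using assms(2)
  proof eventually_elim
    case (elim v)
    have "\<bar>ln \<bar>c\<bar>\<bar> * 1 \<le> \<bar>ln \<bar>c\<bar>\<bar> * \<beta> v" using elim by (intro mult_left_mono) auto
    then have "- \<bar>ln \<bar>c\<bar>\<bar> * \<beta> v \<le> ln \<bar>c\<bar>" "ln \<bar>c\<bar> \<le> \<bar>ln \<bar>c\<bar>\<bar> * \<beta> v" by auto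
    then have "exp (- \<bar>ln \<bar>c\<bar>\<bar> * \<beta> v) \<le> exp (ln \<bar>c\<bar>)" "exp (ln \<bar>c\<bar>) \<le> exp (\<bar>ln \<bar>c\<bar>\<bar> * \<beta> v)"
      by simp_all
    then show ?case using assms(1) by simp
  qed
qed simp

text \<open>Each of the other terms is eventually at most the fraction 1/(2n) of the leading one,
  where n is the number of terms.\<close>

lemma dominant_term:
  assumes "finite I" "k \<in> I" and \<beta>: "eventually (\<lambda>v. 1 \<le> \<beta> v) at_top"
    and dom: "\<And>j. j \<in> I - {k} \<Longrightarrow> dominates \<beta> (z k) (z j)"
    and g: "\<And>j. j \<in> I \<Longrightarrow> tempered \<beta> (g j)"
  shows "eventually (\<lambda>v. \<bar>\<Sum>j\<in>I - {k}. g j v * exp (z j v)\<bar> \<le> (1/2) * (\<bar>g k v\<bar> * exp (z k v))) at_top"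
proof -
  define n where "n = real (card I)"
  have n: "n \<ge> 1" using assms(1,2) card_gt_0_iff[of I] by (auto simp: n_def)
  obtain Kk where Kk: "eventually (\<lambda>v. exp (- Kk * \<beta> v) \<le> \<bar>g k v\<bar>) at_top"
    using temperedE[OF g[OF assms(2)]] by blast
  have each: "eventually (\<lambda>v. \<bar>g j v * exp (z j v)\<bar> \<le> (\<bar>g k v\<bar> * exp (z k v)) / (2 * n)) at_top"
    if j: "j \<in> I - {k}" for j
  proof -
    obtain K where K: "eventually (\<lambda>v. \<bar>g j v\<bar> \<le> exp (K * \<beta> v)) at_top"
      using temperedE[OF g[of j]] j by blast
    \<comment> \<open>The multiple is chosen to absorb three losses: the upper bound on
      \<open>g j\<close>, the lower bound on \<open>g k\<close>, and the factor \<open>2 * n\<close>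
      (here \<open>\<beta> v \<ge> 1\<close> enters).\<close>
    have D: "eventually (\<lambda>v. (K + Kk + ln (2 * n)) * \<beta> v \<le> z k v - z j v) at_top"
      using dom[OF j] unfolding dominates_def by blast
    show ?thesis using K Kk D \<beta>
    proof eventually_elim
      case (elim v)
      have "ln (2 * n) * 1 \<le> ln (2 * n) * \<beta> v" using elim n by (intro mult_left_mono) auto
      then have le: "ln (2 * n) + (K * \<beta> v + z j v) \<le> - Kk * \<beta> v + z k v"
        using elim(3) by (simp add: algebra_simps)
      have "2 * n * \<bar>g j v * exp (z j v)\<bar> \<le> 2 * n * (exp (K * \<beta> v) * exp (z j v))"
        using elim n by (simp add: abs_mult)
      also have "\<dots> = exp (ln (2 * n) + (K * \<beta> v + z j v))" using n by (simp add: exp_add)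
      also have "\<dots> \<le> exp (- Kk * \<beta> v + z k v)" using le by simp
      also have "\<dots> = exp (- Kk * \<beta> v) * exp (z k v)" by (rule exp_add)
      also have "\<dots> \<le> \<bar>g k v\<bar> * exp (z k v)" using elim by (intro mult_right_mono) auto
      finally show ?case using n by (simp add: field_simps)
    qed
  qed
  have "eventually (\<lambda>v. \<forall>j\<in>I - {k}. \<bar>g j v * exp (z j v)\<bar> \<le> (\<bar>g k v\<bar> * exp (z k v)) / (2 * n)) at_top"
    using assms(1) each by (intro eventually_ball_finite) auto
  then show ?thesis
  proof eventually_elim
    case (elim v)
    let ?t = "\<bar>g k v\<bar> * exp (z k v)"
    have "\<bar>\<Sum>j\<in>I - {k}. g j v * exp (z j v)\<bar> \<le> (\<Sum>j\<in>I - {k}. \<bar>g j v * exp (z j v)\<bar>)"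
      by (rule sum_abs)
    also have "\<dots> \<le> (\<Sum>j\<in>I - {k}. ?t / (2 * n))" using elim by (intro sum_mono) auto
    also have "\<dots> = real (card (I - {k})) * (?t / (2 * n))" by simp
    also have "\<dots> \<le> n * (?t / (2 * n))"
      using assms(1) n by (intro mult_right_mono) (auto simp: n_def intro!: card_mono)
    also have "\<dots> = (1/2) * ?t" using n by simp
    finally show ?case .
  qed
qed

text \<open>Weights at least 1 exclude cancellation and let every reached exponent grow at least
  like \<open>exp\<close> of a predecessor's exponent, up to the constant 1. Distinct weights on the
  edges leaving a common node keep two exponents of one level apart.\<close>

locale exp_network =
  fixes N :: "'a set" and E :: "('a \<times> 'a) set" and W :: "'a \<Rightarrow> 'a \<Rightarrow> real" and e :: 'a
  assumes finite_N: "finite N" and E_sub: "E \<subseteq> N \<times> N" and e_in_N: "e \<in> N"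
    and W_consistent: "consistent E W"
    and W_ge_1: "\<And>i j. (i, j) \<in> E \<Longrightarrow> W i j \<ge> 1"
    and W_distinct: "\<And>i j k. (i, k) \<in> E \<Longrightarrow> (j, k) \<in> E \<Longrightarrow> i \<noteq> j \<Longrightarrow> W i k \<noteq> W j k"
begin

text \<open>
  For $f(x) = e^x - 1$ and an impulse of amplitude $e^v - 1$ at \<open>e\<close>, the output of node \<open>i\<close>
  after \<open>s\<close> steps is \<open>exp (z s i v) - 1\<close>.
\<close>
primrec z :: "nat \<Rightarrow> 'a \<Rightarrow> real \<Rightarrow> real" where
  "z 0 = (\<lambda>i v. if i = e then v else 0)"
| "z (Suc s) = (\<lambda>i v. \<Sum>j\<in>N. W i j * (exp (z s j v) - 1))"

primrec R :: "nat \<Rightarrow> 'a set" where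
  "R 0 = {e}"
| "R (Suc s) = {i. \<exists>j\<in>R s. (i, j) \<in> E}"

definition B :: "nat \<Rightarrow> real \<Rightarrow> real" where
  "B s v = (\<Sum>i\<in>N. z s i v)"

text \<open>
  \<open>\<beta> s\<close> is the scale of level \<open>s\<close>: it dominates all exponents of lower levels, while every
  \<open>z s i\<close> with \<open>i \<in> R s\<close>, and every difference of two of them, outgrows all multiples of it.
\<close>
primrec \<beta> :: "nat \<Rightarrow> real \<Rightarrow> real" where
  "\<beta> 0 = (\<lambda>v. 1)"
| "\<beta> (Suc s) = (\<lambda>v. \<beta> s v + B s v)"

section \<open>Growth and separation of the exponents\<close>

lemma R_sub: "R s \<subseteq> N"
  using E_sub e_in_N by (cases s) auto

lemma finite_R: "finite (R s)"
  using R_sub finite_N finite_subset by blast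

lemma W_eq_0: "(i, j) \<notin> E \<Longrightarrow> W i j = 0"
  using W_consistent by (auto simp: consistent_def)

lemma W_nonneg: "W i j \<ge> 0"
  using W_ge_1[of i j] W_eq_0[of i j] by (cases "(i, j) \<in> E") auto

lemma z_unreached: "i \<notin> R s \<Longrightarrow> z s i v = 0"
proof (induction s arbitrary: i)
  case (Suc s)
  have "W i j * (exp (z s j v) - 1) = 0" for j
    using Suc W_eq_0[of i j] by (cases "(i, j) \<in> E") auto
  then show ?case unfolding z.simps by (intro sum.neutral) blast
qed simp

lemma z_nonneg: "v \<ge> 0 \<Longrightarrow> z s i v \<ge> 0"
proof (induction s arbitrary: i)
  case (Suc s) then show ?case by (auto intro!: sum_nonneg mult_nonneg_nonneg W_nonneg)
qed auto

lemma z_at_0: "z s i 0 = 0"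
  by (induction s arbitrary: i) auto

lemma B_nonneg: "v \<ge> 0 \<Longrightarrow> B s v \<ge> 0"
  by (auto simp: B_def intro!: sum_nonneg z_nonneg)

lemma z_le_B: "v \<ge> 0 \<Longrightarrow> z s i v \<le> B s v"
proof (cases "i \<in> N")
  case True
  assume "v \<ge> 0"
  then show ?thesis unfolding B_def by (intro member_le_sum True finite_N z_nonneg)
next
  case False
  assume "v \<ge> 0"
  moreover have "i \<notin> R s" using False R_sub by blast
  ultimately show ?thesis using z_unreached[of i s v] B_nonneg[of v s] by simp
qed

lemma \<beta>_ge_1: "v \<ge> 0 \<Longrightarrow> \<beta> s v \<ge> 1"
  by (induction s) (auto intro: add_increasing2 B_nonneg)

lemma \<beta>_mono: "v \<ge> 0 \<Longrightarrow> \<beta> s v \<le> \<beta> (Suc s) v"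
  using B_nonneg[of v s] by simp

lemma z_le_\<beta>: "v \<ge> 0 \<Longrightarrow> z s i v \<le> \<beta> (Suc s) v"
  using \<beta>_ge_1[of v s] z_le_B[of v s i] by simp

lemma z_Suc_lower:
  assumes "(i, k) \<in> E" "v \<ge> 0" shows "exp (z s k v) - 1 \<le> z (Suc s) i v"
proof -
  have "1 * (exp (z s k v) - 1) \<le> W i k * (exp (z s k v) - 1)"
    using W_ge_1[OF assms(1)] z_nonneg[OF assms(2)] by (intro mult_right_mono) auto
  also have "\<dots> \<le> (\<Sum>j\<in>N. W i j * (exp (z s j v) - 1))"
    using assms E_sub
    by (intro member_le_sum[where f = "\<lambda>j. W i j * (exp (z s j v) - 1)"] finite_N mult_nonneg_nonneg W_nonneg)
      (auto intro: z_nonneg)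
  finally show ?thesis by simp
qed

text \<open>Allows one-variable estimates in u to be transported along u =
  \<open>z s i v\<close>.\<close>

lemma z_at_top: "i \<in> R s \<Longrightarrow> filterlim (z s i) at_top at_top"
proof (induction s arbitrary: i)
  case 0 then show ?case by (simp add: filterlim_ident)
next
  case (Suc s)
  then obtain k where k: "k \<in> R s" "(i, k) \<in> E" by auto
  have "eventually (\<lambda>v. z s k v \<le> z (Suc s) i v) at_top"
    using eventually_ge_at_top[of 0]
  proof eventually_elim
    case (elim v)
    then show ?case using z_Suc_lower[OF k(2) elim, of s] exp_ge_add_one_self[of "z s k v"] by linarith
  qed
  then show ?case using filterlim_at_top_mono Suc.IH[OF k(1)] by blast
qed

lemma B_Suc_upper:
  obtains C where "C \<ge> 0" "\<And>s v. v \<ge> 0 \<Longrightarrow> B (Suc s) v \<le> C * exp (B s v)"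
proof
  show "(\<Sum>i\<in>N. \<Sum>j\<in>N. W i j) \<ge> 0" by (intro sum_nonneg W_nonneg)
  fix s v assume v: "v \<ge> (0::real)"
  have "exp (z s j v) - 1 \<le> exp (B s v)" for j
  proof -
    have "exp (z s j v) \<le> exp (B s v)" using z_le_B[OF v, of s j] by simp
    then show ?thesis by linarith
  qed
  then have "B (Suc s) v \<le> (\<Sum>i\<in>N. \<Sum>j\<in>N. W i j * exp (B s v))"
    unfolding B_def[of "Suc s"] z.simps
    by (intro sum_mono mult_left_mono W_nonneg)
  then show "B (Suc s) v \<le> (\<Sum>i\<in>N. \<Sum>j\<in>N. W i j) * exp (B s v)"
    by (simp add: sum_distrib_right)
qed

text \<open>Exponents of one level may differ greatly, yet \<open>exp\<close> of even the smallest
  reached one outgrows the sum of all of them: passing to the next level applies \<open>exp\<close>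
  once more, and exp(u/2) is negligible against exp(u).\<close>

lemma \<beta>_subexp:
  assumes "i \<in> R s" "\<epsilon> > 0"
  shows "eventually (\<lambda>v. \<beta> (Suc s) v \<le> exp (\<epsilon> * z s i v)) at_top"
  using assms
proof (induction s arbitrary: i \<epsilon>)
  case 0
  have "B 0 v = v" for v using e_in_N finite_N by (simp add: B_def)
  moreover have "eventually (\<lambda>v. 1 + v \<le> exp (\<epsilon> * v)) at_top" using 0(2) by real_asymp
  ultimately show ?case using 0(1) by simp
next
  case (Suc s)
  then obtain k where k: "k \<in> R s" "(i, k) \<in> E" by auto
  obtain C where C: "C \<ge> 0" "\<And>s v. v \<ge> 0 \<Longrightarrow> B (Suc s) v \<le> C * exp (B s v)"
    using B_Suc_upper by blast
  \<comment> \<open>Here u will be \<open>z s k v\<close> for a reached predecessor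
    \<open>k\<close>. The induction hypothesis with constant 1/2 bounds \<open>B s v\<close> by
    exp(u/2), hence \<open>B (Suc s) v\<close> by a multiple of exp(exp(u/2)), while
    \<open>z (Suc s) i v\<close> is at least exp(u) - 1.\<close>
  have "eventually (\<lambda>u. (1 + C) * exp (exp (u/2)) \<le> exp (\<epsilon> * (exp u - 1))) at_top"
    using C(1) Suc.prems(2) by real_asymp
  then have "eventually (\<lambda>v. (1 + C) * exp (exp (z s k v/2)) \<le> exp (\<epsilon> * (exp (z s k v) - 1))) at_top"
    using z_at_top[OF k(1)] by (rule eventually_compose_filterlim)
  moreover have "eventually (\<lambda>v. \<beta> (Suc s) v \<le> exp (1/2 * z s k v)) at_top"
    by (rule Suc.IH[OF k(1)]) simp
  ultimately show ?case using eventually_ge_at_top[of 0]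
  proof eventually_elim
    case (elim v)
    have b: "\<beta> (Suc s) v \<le> exp (z s k v / 2)" using elim by simp
    have "B s v \<le> \<beta> (Suc s) v" using \<beta>_ge_1[OF elim(3), of s] by simp
    then have "exp (B s v) \<le> exp (exp (z s k v / 2))" using b by simp
    then have "C * exp (B s v) \<le> C * exp (exp (z s k v / 2))" using C(1) by (rule mult_left_mono)
    moreover have "\<beta> (Suc s) v \<le> exp (exp (z s k v / 2))"
      using b exp_ge_add_one_self[of "exp (z s k v / 2)"] by linarith
    ultimately have "\<beta> (Suc (Suc s)) v \<le> (1 + C) * exp (exp (z s k v / 2))"
      using C(2)[OF elim(3), of s] by (simp add: algebra_simps)
    also have "\<dots> \<le> exp (\<epsilon> * (exp (z s k v) - 1))" using elim by simp
    also have "\<dots> \<le> exp (\<epsilon> * z (Suc s) i v)"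
      using z_Suc_lower[OF k(2) elim(3), of s] Suc.prems(2) by simp
    finally show ?case .
  qed
qed

lemma \<beta>_le_exp:
  assumes "k \<in> R s" "c > 0"
  shows "eventually (\<lambda>v. K * \<beta> (Suc s) v \<le> c * exp (z s k v) - K') at_top"
proof -
  have "eventually (\<lambda>u. \<bar>K\<bar> * exp (u/2) \<le> c * exp u - K') at_top"
    using assms(2) by real_asymp
  then have "eventually (\<lambda>v. \<bar>K\<bar> * exp (z s k v / 2) \<le> c * exp (z s k v) - K') at_top"
    using z_at_top[OF assms(1)] by (rule eventually_compose_filterlim)
  moreover have "eventually (\<lambda>v. \<beta> (Suc s) v \<le> exp (1/2 * z s k v)) at_top"
    by (rule \<beta>_subexp[OF assms(1)]) simp
  ultimately show ?thesis using eventually_ge_at_top[of 0]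
  proof eventually_elim
    case (elim v)
    have "K * \<beta> (Suc s) v \<le> \<bar>K\<bar> * \<beta> (Suc s) v"
      using \<beta>_ge_1[OF elim(3), of "Suc s"] by (intro mult_right_mono) auto
    also have "\<dots> \<le> \<bar>K\<bar> * exp (z s k v / 2)" using elim by (intro mult_left_mono) auto
    finally show ?case using elim by linarith
  qed
qed

lemma z_dominates_0:
  assumes "i \<in> R s" shows "dominates (\<beta> s) (z s i) (\<lambda>_. 0)"
proof (cases s)
  case 0 then show ?thesis using assms by (auto simp: dominates_def eventually_ge_at_top)
next
  case (Suc t)
  then obtain k where k: "k \<in> R t" "(i, k) \<in> E" using assms by auto
  show ?thesis unfolding dominates_def Suc
  proof
    fix K
    have "eventually (\<lambda>v. K * \<beta> (Suc t) v \<le> 1 * exp (z t k v) - 1) at_top"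
      by (rule \<beta>_le_exp[OF k(1)]) simp
    then show "eventually (\<lambda>v. K * \<beta> (Suc t) v \<le> z (Suc t) i v - 0) at_top"
      using eventually_ge_at_top[of 0]
    proof eventually_elim
      case (elim v)
      then show ?case using z_Suc_lower[OF k(2) elim(2), of t] by simp
    qed
  qed
qed

lemma eventually_\<beta>_ge_1: "eventually (\<lambda>v. 1 \<le> \<beta> s v) at_top"
  using eventually_ge_at_top[of 0] by eventually_elim (rule \<beta>_ge_1)

text \<open>One level up, the difference of two exponents is a combination of the terms
  \<open>exp (z s k v) - 1\<close> with coefficients \<open>W i k - W j k\<close>. By induction one
  of the terms with nonzero coefficient prevails, and it exceeds all multiples of the next
  scale.\<close>

lemma z_separated:
  assumes "i \<in> R s" "j \<in> R s" "i \<noteq> j"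
  shows "dominates (\<beta> s) (z s i) (z s j) \<or> dominates (\<beta> s) (z s j) (z s i)"
  using assms
proof (induction s arbitrary: i j)
  case (Suc s)
  define c where "c = (\<lambda>k. W i k - W j k)"
  define I where "I = {k \<in> R s. c k \<noteq> 0}"
  obtain k0 where k0: "k0 \<in> R s" "(i, k0) \<in> E" using Suc.prems by auto
  \<comment> \<open>Either \<open>j\<close> is not a successor of \<open>k0\<close>, and the
    coefficient is a weight at least 1, or distinctness of the weights leaving \<open>k0\<close>
    applies.\<close>
  then have "c k0 \<noteq> 0"
    using W_ge_1[OF k0(2)] W_distinct[OF k0(2), of j] W_eq_0[of j k0] Suc.prems(3)
    by (cases "(j, k0) \<in> E") (auto simp: c_def)
  then have ne: "I \<noteq> {}" using k0 by (auto simp: I_def)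
  have fin: "finite I" using finite_R by (auto simp: I_def)
  obtain k where k: "k \<in> I" and dom: "\<forall>j\<in>I - {k}. dominates (\<beta> s) (z s k) (z s j)"
    using dominates_max[OF fin ne, of "\<beta> s" "z s"] Suc.IH by (auto simp: I_def)
  have kR: "k \<in> R s" "c k \<noteq> 0" using k by (auto simp: I_def)
  define S where "S = (\<Sum>l\<in>I. c l)"
  have small: "eventually (\<lambda>v. \<bar>\<Sum>l\<in>I - {k}. c l * exp (z s l v)\<bar> \<le> (1/2) * (\<bar>c k\<bar> * exp (z s k v))) at_top"
    using fin k dom by (intro dominant_term[where \<beta> = "\<beta> s"] eventually_\<beta>_ge_1 tempered_const) (auto simp: I_def)
  have diff: "z (Suc s) i v - z (Suc s) j v =
      c k * exp (z s k v) + (\<Sum>l\<in>I - {k}. c l * exp (z s l v)) - S" for v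
  proof -
    have "z (Suc s) i v - z (Suc s) j v = (\<Sum>l\<in>N. c l * (exp (z s l v) - 1))"
      unfolding z.simps sum_subtractf[symmetric]
      by (rule sum.cong) (auto simp: c_def algebra_simps)
    also have "\<dots> = (\<Sum>l\<in>I. c l * (exp (z s l v) - 1))"
      using R_sub finite_N by (intro sum.mono_neutral_right) (auto simp: I_def, metis z_unreached)
    also have "\<dots> = (\<Sum>l\<in>I. c l * exp (z s l v)) - S"
      by (simp add: S_def algebra_simps sum_subtractf)
    also have "(\<Sum>l\<in>I. c l * exp (z s l v)) = c k * exp (z s k v) + (\<Sum>l\<in>I - {k}. c l * exp (z s l v))"
      by (rule sum.remove[OF fin k])
    finally show ?thesis .
  qed
  \<comment> \<open>The sign of the leading coefficient decides which of the two exponents is the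
    larger; multiplying by it treats both cases at once.\<close>
  have main: "eventually (\<lambda>v. K * \<beta> (Suc s) v \<le> sgn (c k) * (z (Suc s) i v - z (Suc s) j v)) at_top" for K
  proof -
    have "eventually (\<lambda>v. K * \<beta> (Suc s) v \<le> (\<bar>c k\<bar> / 2) * exp (z s k v) - \<bar>S\<bar>) at_top"
      using kR by (intro \<beta>_le_exp) auto
    with small show ?thesis
    proof eventually_elim
      case (elim v)
      define x T where "x = exp (z s k v)" and "T = (\<Sum>l\<in>I - {k}. c l * exp (z s l v))"
      have T: "\<bar>T\<bar> \<le> (\<bar>c k\<bar> / 2) * x" and K: "K * \<beta> (Suc s) v \<le> (\<bar>c k\<bar> / 2) * x - \<bar>S\<bar>"
        using elim by (simp_all add: x_def T_def)
      have "sgn (c k) * (c k * x + T - S) = \<bar>c k\<bar> * x + sgn (c k) * (T - S)"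
        by (simp add: algebra_simps abs_sgn)
      moreover have "\<bar>sgn (c k) * (T - S)\<bar> \<le> \<bar>T\<bar> + \<bar>S\<bar>"
        using kR(2) by (simp add: abs_mult abs_sgn_eq)
      ultimately have "K * \<beta> (Suc s) v \<le> sgn (c k) * (c k * x + T - S)"
        using T K by linarith
      then show ?case unfolding diff x_def T_def .
    qed
  qed
  show ?case
  proof (cases "c k > 0")
    case True
    then show ?thesis using main by (auto simp: dominates_def)
  next
    case False
    then have "sgn (c k) = -1" using kR(2) by (auto simp: sgn_if)
    then show ?thesis using main by (auto simp: dominates_def)
  qed
qed simp

section \<open>Linear independence of exponentials over coefficients of slower growth\<close>

definition I :: "nat \<Rightarrow> 'a option set" where
  "I s = insert None (Some ` R s)"

text \<open>\<open>None\<close> carries the exponent 0: it collects the terms without an exponential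
  factor of level \<open>s\<close>, which compete with the others in the same way.\<close>

definition zo :: "nat \<Rightarrow> 'a option \<Rightarrow> real \<Rightarrow> real" where
  "zo s p v = (case p of None \<Rightarrow> 0 | Some i \<Rightarrow> z s i v)"

lemma finite_I: "finite (I s)"
  using finite_R by (simp add: I_def)

lemma sum_I: "(\<Sum>p\<in>I s. h p) = h None + (\<Sum>i\<in>R s. h (Some i))"
  using finite_R by (simp add: I_def sum.reindex)

lemma zo_separated:
  assumes "p \<in> I s" "q \<in> I s" "p \<noteq> q"
  shows "dominates (\<beta> s) (zo s p) (zo s q) \<or> dominates (\<beta> s) (zo s q) (zo s p)"
proof -
  have zo: "zo s None = (\<lambda>_. 0)" "zo s (Some i) = z s i" for i by (auto simp: zo_def)
  show ?thesis
  proof (cases p)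
    case None
    then show ?thesis using assms z_dominates_0 zo by (auto simp: I_def)
  next
    case (Some i)
    note p = this
    show ?thesis
    proof (cases q)
      case None
      then show ?thesis using assms z_dominates_0 zo p by (auto simp: I_def)
    next
      case (Some j)
      then have "i \<in> R s" "j \<in> R s" "i \<noteq> j" using assms p by (auto simp: I_def)
      from z_separated[OF this] show ?thesis by (simp add: zo p Some)
    qed
  qed
qed

text \<open>
  A nonzero member of \<open>V s\<close> cannot decay faster than some \<open>exp (- K * \<beta> s v)\<close>. Without this lower
  bound the term with the largest exponent could not be isolated in a vanishing sum.
\<close>
primrec V :: "nat \<Rightarrow> (real \<Rightarrow> real) set" where
  "V 0 = range (\<lambda>c v. c)"
| "V (Suc s) = {\<lambda>v. \<Sum>p\<in>I s. g p v * exp (zo s p v) | g. \<forall>p\<in>I s. g p \<in> V s}"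

text \<open>Coefficients that vanish eventually are not tempered and are discarded first; among the
  remaining indices one exponent dominates all others.\<close>

lemma leading_term:
  assumes "\<And>p. p \<in> I s \<Longrightarrow> eventually (\<lambda>v. g p v = 0) at_top \<or> tempered (\<beta> s) (g p)"
    and "\<exists>p\<in>I s. \<not> eventually (\<lambda>v. g p v = 0) at_top"
  obtains k where "k \<in> I s" "tempered (\<beta> s) (g k)"
    "eventually (\<lambda>v. \<bar>(\<Sum>p\<in>I s. g p v * exp (zo s p v)) - g k v * exp (zo s k v)\<bar>
       \<le> (1/2) * (\<bar>g k v\<bar> * exp (zo s k v))) at_top"
proof -
  define J where "J = {p \<in> I s. \<not> eventually (\<lambda>v. g p v = 0) at_top}"
  have J: "finite J" "J \<noteq> {}" "J \<subseteq> I s" using assms(2) finite_I by (auto simp: J_def)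
  obtain k where k: "k \<in> J" "\<forall>j\<in>J - {k}. dominates (\<beta> s) (zo s k) (zo s j)"
    using dominates_max[OF J(1,2), of "\<beta> s" "zo s"] zo_separated J(3) by blast
  have small: "eventually (\<lambda>v. \<bar>\<Sum>j\<in>J - {k}. g j v * exp (zo s j v)\<bar> \<le> (1/2) * (\<bar>g k v\<bar> * exp (zo s k v))) at_top"
    using k J assms(1) by (intro dominant_term[where \<beta> = "\<beta> s"] eventually_\<beta>_ge_1) (auto simp: J_def)
  have "eventually (\<lambda>v. \<forall>p\<in>I s - J. g p v = 0) at_top"
    using finite_I by (intro eventually_ball_finite) (auto simp: J_def)
  with small have "eventually (\<lambda>v. \<bar>(\<Sum>p\<in>I s. g p v * exp (zo s p v)) - g k v * exp (zo s k v)\<bar>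
       \<le> (1/2) * (\<bar>g k v\<bar> * exp (zo s k v))) at_top"
  proof eventually_elim
    case (elim v)
    have "(\<Sum>p\<in>I s. g p v * exp (zo s p v)) = (\<Sum>p\<in>J. g p v * exp (zo s p v))"
      using elim J finite_I by (intro sum.mono_neutral_right) auto
    also have "\<dots> = g k v * exp (zo s k v) + (\<Sum>j\<in>J - {k}. g j v * exp (zo s j v))"
      by (rule sum.remove[OF J(1) k(1)])
    finally show ?case using elim by simp
  qed
  moreover have "k \<in> I s" "tempered (\<beta> s) (g k)" using k assms(1) by (auto simp: J_def)
  ultimately show ?thesis using that by blast
qed

lemma zo_bounds: "v \<ge> 0 \<Longrightarrow> 0 \<le> zo s p v \<and> zo s p v \<le> \<beta> (Suc s) v"
  using z_nonneg z_le_\<beta> \<beta>_ge_1[of v "Suc s"] by (auto simp: zo_def split: option.splits)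

text \<open>By induction the sum lies within a factor 2 of its leading term, whose coefficient is
  tempered at the lower scale and whose exponent lies between 0 and the next scale.\<close>

lemma V_tempered:
  "h \<in> V s \<Longrightarrow> eventually (\<lambda>v. h v = 0) at_top \<or> tempered (\<beta> s) h"
proof (induction s arbitrary: h)
  case 0
  then obtain c where "h = (\<lambda>_. c)" by auto
  then show ?case using tempered_const[OF _ eventually_\<beta>_ge_1, of c 0] by (cases "c = 0") auto
next
  case (Suc s)
  then obtain g where h: "h = (\<lambda>v. \<Sum>p\<in>I s. g p v * exp (zo s p v))" and g: "\<forall>p\<in>I s. g p \<in> V s"
    by auto
  show ?case
  proof (cases "\<exists>p\<in>I s. \<not> eventually (\<lambda>v. g p v = 0) at_top")
    case False
    then have "eventually (\<lambda>v. \<forall>p\<in>I s. g p v = 0) at_top"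
      using finite_I by (intro eventually_ball_finite) auto
    then have "eventually (\<lambda>v. h v = 0) at_top" unfolding h by eventually_elim simp
    then show ?thesis ..
  next
    case True
    obtain k where k: "k \<in> I s" "tempered (\<beta> s) (g k)"
      and lead: "eventually (\<lambda>v. \<bar>h v - g k v * exp (zo s k v)\<bar> \<le> (1/2) * (\<bar>g k v\<bar> * exp (zo s k v))) at_top"
      using leading_term[of s g] Suc.IH g True unfolding h by blast
    obtain K where K: "K \<ge> 0" "eventually (\<lambda>v. exp (- K * \<beta> s v) \<le> \<bar>g k v\<bar> \<and> \<bar>g k v\<bar> \<le> exp (K * \<beta> s v)) at_top"
      using k(2) unfolding tempered_def by blast
    \<comment> \<open>In the upper bound, one unit of the added 2 pays for the exponent
      \<open>zo s k v\<close>, the other for the constant factor 2, as \<open>2 \<le> exp 1\<close>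
      and \<open>\<beta> (Suc s) v \<ge> 1\<close>.\<close>
    have "eventually (\<lambda>v. exp (- (K + 2) * \<beta> (Suc s) v) \<le> \<bar>h v\<bar> \<and> \<bar>h v\<bar> \<le> exp ((K + 2) * \<beta> (Suc s) v)) at_top"
      using lead K(2) eventually_ge_at_top[of 0]
    proof eventually_elim
      case (elim v)
      let ?b = "\<beta> (Suc s) v" let ?t = "\<bar>g k v\<bar> * exp (zo s k v)"
      have b1: "1 \<le> ?b" using elim by (intro \<beta>_ge_1)
      have bb: "K * \<beta> s v \<le> K * ?b" using elim K(1) by (intro mult_left_mono \<beta>_mono)
      have zz: "0 \<le> zo s k v" "zo s k v \<le> ?b" using zo_bounds elim by blast+
      have t: "\<bar>g k v * exp (zo s k v)\<bar> = ?t" by (simp add: abs_mult)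
      have h1: "(1/2) * ?t \<le> \<bar>h v\<bar>" "\<bar>h v\<bar> \<le> 2 * ?t" using elim(1) t by linarith+
      have e2: "2 \<le> exp (1::real)" using exp_ge_add_one_self[of 1] by simp
      then have e3: "exp (-1) \<le> (1/2::real)" by (simp add: exp_minus field_simps)
      have "exp (- (K + 2) * ?b) \<le> exp (- 1 + (- K * \<beta> s v + zo s k v))"
        using b1 bb zz by (simp add: algebra_simps)
      also have "\<dots> = exp (-1) * (exp (- K * \<beta> s v) * exp (zo s k v))" by (simp only: exp_add)
      also have "\<dots> \<le> (1/2) * ?t" using e3 elim by (intro mult_mono) auto
      finally have low: "exp (- (K + 2) * ?b) \<le> (1/2) * ?t" .
      have "2 * ?t \<le> exp 1 * (exp (K * \<beta> s v) * exp (zo s k v))"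
        using e2 elim by (intro mult_mono) auto
      also have "\<dots> = exp (1 + (K * \<beta> s v + zo s k v))" by (simp only: exp_add)
      also have "\<dots> \<le> exp ((K + 2) * ?b)" using b1 bb zz by (simp add: algebra_simps)
      finally show ?case using low h1 by linarith
    qed
    then show ?thesis using K(1) unfolding tempered_def by (intro disjI2 exI[of _ "K + 2"]) auto
  qed
qed

text \<open>If some coefficient survived, the sum would differ from a leading term by at most half
  its size. By temperedness this term is eventually nonzero, so the sum could not vanish.\<close>

lemma V_exp_independent:
  assumes g: "\<And>p. p \<in> I s \<Longrightarrow> g p \<in> V s"
    and z: "eventually (\<lambda>v. (\<Sum>p\<in>I s. g p v * exp (zo s p v)) = 0) at_top" and p: "p \<in> I s"
  shows "eventually (\<lambda>v. g p v = 0) at_top"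
proof (rule ccontr)
  assume "\<not> ?thesis"
  with p have ex: "\<exists>p\<in>I s. \<not> eventually (\<lambda>v. g p v = 0) at_top" by blast
  obtain k where k: "k \<in> I s" "tempered (\<beta> s) (g k)"
    and lead: "eventually (\<lambda>v. \<bar>(\<Sum>p\<in>I s. g p v * exp (zo s p v)) - g k v * exp (zo s k v)\<bar>
      \<le> (1/2) * (\<bar>g k v\<bar> * exp (zo s k v))) at_top"
    using leading_term[of s g, OF _ ex] V_tempered g by blast
  obtain K where "eventually (\<lambda>v. exp (- K * \<beta> s v) \<le> \<bar>g k v\<bar>) at_top"
    using temperedE[OF k(2)] by blast
  with lead z have "eventually (\<lambda>v. False) (at_top :: real filter)"
  proof eventually_elim
    case (elim v)
    have "0 < \<bar>g k v\<bar>" using elim(3) exp_gt_zero[of "- K * \<beta> s v"] by linarith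
    then have "0 < \<bar>g k v\<bar> * exp (zo s k v)" by simp
    then show False using elim(1,2) by (simp add: abs_mult)
  qed
  then show False by simp
qed

lemma V_mono: assumes "h \<in> V s" and c: "(\<lambda>_. 0) \<in> V s" shows "h \<in> V (Suc s)"
  using assms unfolding V.simps
  by (auto intro!: exI[of _ "\<lambda>p. if p = None then h else (\<lambda>_. 0)"] simp: sum_I zo_def)

lemma V_const: "(\<lambda>_. c) \<in> V s"
proof (induction s arbitrary: c)
  case (Suc s) then show ?case by (intro V_mono)
qed auto

lemma V_add: "h \<in> V s \<Longrightarrow> h' \<in> V s \<Longrightarrow> (\<lambda>v. h v + h' v) \<in> V s"
proof (induction s arbitrary: h h')
  case (Suc s)
  then obtain g g' where "h = (\<lambda>v. \<Sum>p\<in>I s. g p v * exp (zo s p v))" "\<forall>p\<in>I s. g p \<in> V s"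
    "h' = (\<lambda>v. \<Sum>p\<in>I s. g' p v * exp (zo s p v))" "\<forall>p\<in>I s. g' p \<in> V s" by auto
  then show ?case using Suc.IH
    by (auto intro!: exI[of _ "\<lambda>p v. g p v + g' p v"] simp: algebra_simps sum.distrib)
qed auto

lemma V_cmult: "h \<in> V s \<Longrightarrow> (\<lambda>v. c * h v) \<in> V s"
proof (induction s arbitrary: h)
  case (Suc s)
  then obtain g where "h = (\<lambda>v. \<Sum>p\<in>I s. g p v * exp (zo s p v))" "\<forall>p\<in>I s. g p \<in> V s" by auto
  then show ?case using Suc.IH
    by (auto intro!: exI[of _ "\<lambda>p v. c * g p v"] simp: algebra_simps sum_distrib_left)
qed auto

section \<open>Directional derivatives of the responses\<close>

lemma z_analytic: "real_analytic (z s i)"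
proof (induction s arbitrary: i)
  case 0
  have "z 0 i = (if i = e then (\<lambda>v. v) else (\<lambda>v. 0))" by auto
  then show ?case using real_analytic_id real_analytic_const by auto
next
  case (Suc s)
  then show ?case unfolding z.simps
    by (intro real_analytic_sum real_analytic_mult real_analytic_diff real_analytic_const real_analytic_exp)
qed

text \<open>
  Up to the factor \<open>exp (z s i v)\<close>, the directional derivative in direction \<open>d\<close> of the
  output of node \<open>i\<close> after \<open>s\<close> steps.
\<close>
primrec dz :: "('a \<times> 'a \<Rightarrow> real) \<Rightarrow> nat \<Rightarrow> 'a \<Rightarrow> real \<Rightarrow> real" where
  "dz d 0 = (\<lambda>i v. 0)"
| "dz d (Suc s) = (\<lambda>i v. \<Sum>j\<in>N. W i j * (exp (z s j v) * dz d s j v) + d (i, j) * (exp (z s j v) - 1))"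

lemma dz_at_0: "dz d s i 0 = 0"
  by (induction s arbitrary: i) (auto simp: z_at_0)

lemma dz_analytic: "real_analytic (dz d s i)"
proof (induction s arbitrary: i)
  case 0 then show ?case by (simp add: real_analytic_const)
next
  case (Suc s)
  then show ?case unfolding dz.simps
    by (intro real_analytic_sum real_analytic_add real_analytic_mult real_analytic_diff real_analytic_const
      real_analytic_exp z_analytic)
qed

context
  fixes d :: "'a \<times> 'a \<Rightarrow> real"
  assumes d_outside: "\<And>p. p \<notin> E \<Longrightarrow> d p = 0"
begin

lemma dz_unreached: "i \<notin> R s \<Longrightarrow> dz d s i v = 0"
proof (induction s arbitrary: i)
  case (Suc s)
  have "W i j * (exp (z s j v) * dz d s j v) + d (i, j) * (exp (z s j v) - 1) = 0" for j
    using Suc W_eq_0[of i j] d_outside[of "(i, j)"] z_unreached[of j s v] by (cases "(i, j) \<in> E") auto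
  then show ?case unfolding dz.simps by (intro sum.neutral) blast
qed simp

text \<open>The recursion for \<open>dz\<close> sorted by exponentials: the constants -1 in
  \<open>exp (z s j v) - 1\<close> gather in the coefficient at \<open>None\<close>.\<close>

definition dz_coeff :: "nat \<Rightarrow> 'a \<Rightarrow> 'a option \<Rightarrow> real \<Rightarrow> real" where
  "dz_coeff s i p = (case p of None \<Rightarrow> (\<lambda>v. - (\<Sum>j\<in>R s. d (i, j))) | Some j \<Rightarrow> (\<lambda>v. W i j * dz d s j v + d (i, j)))"

lemma dz_Suc_expand: "dz d (Suc s) i v = (\<Sum>p\<in>I s. dz_coeff s i p v * exp (zo s p v))"
proof -
  have "dz d (Suc s) i v = (\<Sum>j\<in>R s. W i j * (exp (z s j v) * dz d s j v) + d (i, j) * (exp (z s j v) - 1))"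
    unfolding dz.simps using R_sub finite_N
    by (intro sum.mono_neutral_right) (use z_unreached dz_unreached in auto)
  also have "\<dots> = (\<Sum>j\<in>R s. (W i j * dz d s j v + d (i, j)) * exp (z s j v) - d (i, j))"
    by (rule sum.cong) (auto simp: algebra_simps)
  also have "\<dots> = (\<Sum>p\<in>I s. dz_coeff s i p v * exp (zo s p v))"
    by (simp add: sum_I dz_coeff_def zo_def sum_subtractf)
  finally show ?thesis .
qed

lemma dz_coeff_in_V_if:
  assumes "\<And>j. dz d s j \<in> V s" shows "dz_coeff s i p \<in> V s"
  using assms unfolding dz_coeff_def by (cases p) (auto simp del: dz.simps V.simps intro!: V_const V_add V_cmult)

lemma dz_in_V: "dz d s i \<in> V s"
proof (induction s arbitrary: i)
  case (Suc s)
  have "\<forall>p\<in>I s. dz_coeff s i p \<in> V s" using dz_coeff_in_V_if[OF Suc.IH] by blast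
  then show ?case
    using dz_Suc_expand[of s i] by (auto intro!: exI[of _ "dz_coeff s i"] simp del: dz.simps)
qed auto

lemmas dz_coeff_in_V = dz_coeff_in_V_if[OF dz_in_V]

text \<open>The backward step along an edge. Independence makes
  \<open>W i j * dz d s j v + d (i, j)\<close> vanish for large \<open>v\<close>, analyticity makes
  it vanish everywhere, and evaluation at \<open>v = 0\<close>, where \<open>dz\<close> is 0,
  separates the two summands.\<close>

lemma dz_back:
  assumes "\<And>v. dz d (Suc s) i v = 0" "j \<in> R s"
  shows "d (i, j) = 0" and "(i, j) \<in> E \<Longrightarrow> dz d s j v = 0"
proof -
  have "Some j \<in> I s" using assms(2) by (auto simp: I_def)
  then have "eventually (\<lambda>v. dz_coeff s i (Some j) v = 0) at_top"
    using assms(1) unfolding dz_Suc_expand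
    by (intro V_exp_independent[where g = "dz_coeff s i"]) (auto intro: dz_coeff_in_V)
  then obtain v0 where v0: "\<And>v. v \<ge> v0 \<Longrightarrow> W i j * dz d s j v + d (i, j) = 0"
    by (auto simp: dz_coeff_def eventually_at_top_linorder)
  \<comment> \<open>\<open>v0 + 1\<close> is an interior point of the half-line, so the function
    vanishes in a whole neighbourhood of it.\<close>
  have "eventually (\<lambda>v. W i j * dz d s j v + d (i, j) = 0) (nhds (v0 + 1))"
    using eventually_nhds_in_open[of "{v0<..}" "v0 + 1"] by (rule eventually_mono) (auto intro: v0)
  then have all: "W i j * dz d s j v + d (i, j) = 0" for v
    by (rule real_analytic_identity[rotated])
      (intro real_analytic_add real_analytic_mult real_analytic_const dz_analytic)
  from all[of 0] show d0: "d (i, j) = 0" by (simp add: dz_at_0)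
  show "dz d s j v = 0" if "(i, j) \<in> E"
    using all[of v] d0 W_ge_1[OF that] by auto
qed

text \<open>Composition with \<open>fps_exp 1 - 1\<close> is the substitution of the amplitude
  exp(v) - 1; it turns series in the amplitude into series in \<open>v\<close>.\<close>

lemma z_expansion:
  "(\<lambda>v. exp (z s i v) - 1) has_fps_expansion (impulse_fps N (fps_exp 1 - 1) W e s i oo (fps_exp 1 - 1))"
  and z_Suc_expansion:
  "z (Suc s) i has_fps_expansion (preact_fps N (fps_exp 1 - 1) W e s i oo (fps_exp 1 - 1))"
proof -
  let ?A = "fps_exp 1 - 1 :: real fps"
  let ?Y = "impulse_fps N ?A W e"
  have A: "(\<lambda>v. exp v - 1) has_fps_expansion ?A"
    by (intro has_fps_expansion_diff has_fps_expansion_exp1 has_fps_expansion_1)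
  have pre: "preact_fps N ?A W e s i oo ?A = (\<Sum>j\<in>N. fps_const (W i j) * (?Y s j oo ?A))" for s i
    by (simp add: preact_fps_def fps_compose_sum_distrib fps_compose_mult_distrib)
  have step: "z (Suc s) i has_fps_expansion (preact_fps N ?A W e s i oo ?A)"
    if "\<And>j. (\<lambda>v. exp (z s j v) - 1) has_fps_expansion (?Y s j oo ?A)" for s i
    unfolding pre z.simps by (intro has_fps_expansion_sum has_fps_expansion_cmult_left that)
  show Y: "(\<lambda>v. exp (z s i v) - 1) has_fps_expansion (?Y s i oo ?A)" for s i
  proof (induction s arbitrary: i)
    case 0 then show ?case using A by (auto simp: fps_X_fps_compose_startby0)
  next
    case (Suc s)
    have p0: "fps_nth (preact_fps N ?A W e s i oo ?A) 0 = 0"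
      by (simp add: fps_compose_nth preact_fps_nth_0)
    have "((\<lambda>v. exp v - 1) \<circ> z (Suc s) i) has_fps_expansion (?A oo (preact_fps N ?A W e s i oo ?A))"
      by (intro has_fps_expansion_compose_real A step Suc.IH p0)
    also have "?A oo (preact_fps N ?A W e s i oo ?A) = (?A oo preact_fps N ?A W e s i) oo ?A"
      by (intro fps_compose_assoc) (simp_all add: preact_fps_nth_0)
    finally show ?case by (simp add: o_def preact_fps_def)
  qed
  show "z (Suc s) i has_fps_expansion (preact_fps N ?A W e s i oo ?A)"
    by (rule step[OF Y])
qed

lemma dz_expansion:
  "(\<lambda>v. exp (z s i v) * dz d s i v) has_fps_expansion
    ((\<Sum>p\<in>E. fps_const (d p) * sensitivity_fps N (fps_exp 1 - 1) W W e p s i) oo (fps_exp 1 - 1))"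
proof (induction s arbitrary: i)
  case 0 then show ?case by simp
next
  case (Suc s)
  let ?A = "fps_exp 1 - 1 :: real fps"
  let ?D = "\<lambda>s i. \<Sum>p\<in>E. fps_const (d p) * sensitivity_fps N ?A W W e p s i"
  let ?Z = "preact_fps N ?A W e s i"
  let ?Y = "impulse_fps N ?A W e"
  \<comment> \<open>At \<open>W' = W\<close> the divided difference is a derivative, and that of exp
    x - 1 is exp x: this is the factor \<open>exp (z (Suc s) i v)\<close> split off in the
    definition of \<open>dz\<close>.\<close>
  have c: "(fps_deriv ?A oo ?Z) oo ?A = fps_exp 1 oo (?Z oo ?A)"
  proof -
    have "fps_deriv ?A = fps_exp (1::real)" by simp
    moreover have "(fps_exp 1 oo ?Z) oo ?A = fps_exp 1 oo (?Z oo ?A)"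
      by (rule fps_compose_assoc[symmetric]) (simp_all add: preact_fps_nth_0)
    ultimately show ?thesis by simp
  qed
  have "?D (Suc s) i = (fps_deriv ?A oo ?Z) *
      (\<Sum>j\<in>N. fps_const (W i j) * ?D s j + fps_const (d (i, j)) * ?Y s j)"
    using sum_sensitivity_fps_Suc[where d = d and W = W and W' = W and A = ?A, OF finite_N E_sub]
      d_outside by (simp only: fps_divided_diff_same) blast
  then have D: "?D (Suc s) i oo ?A = (fps_exp 1 oo (?Z oo ?A)) *
      (\<Sum>j\<in>N. fps_const (W i j) * (?D s j oo ?A) + fps_const (d (i, j)) * (?Y s j oo ?A))"
    by (simp add: fps_compose_mult_distrib fps_compose_add_distrib fps_compose_sum_distrib c
        del: sensitivity_fps.simps fps_deriv_sub)
  have p0: "fps_nth (?Z oo ?A) 0 = 0"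
    by (simp add: fps_compose_nth preact_fps_nth_0)
  have "(exp \<circ> z (Suc s) i) has_fps_expansion (fps_exp 1 oo (?Z oo ?A))"
    by (intro has_fps_expansion_compose_real has_fps_expansion_exp1 z_Suc_expansion p0)
  then have "(\<lambda>v. exp (z (Suc s) i v) * dz d (Suc s) i v) has_fps_expansion (?D (Suc s) i oo ?A)"
    unfolding D dz.simps o_def
    by (intro has_fps_expansion_mult has_fps_expansion_sum has_fps_expansion_add has_fps_expansion_cmult_left
      Suc.IH z_expansion)
  then show ?case .
qed

lemma dz_eq_0:
  assumes "(\<Sum>p\<in>E. fps_const (d p) * sensitivity_fps N (fps_exp 1 - 1) W W e p s i) = 0"
  shows "dz d s i v = 0"
proof -
  have "(\<lambda>v. exp (z s i v) * dz d s i v) has_fps_expansion 0"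
    using dz_expansion[of s i] assms by simp
  then have "eventually (\<lambda>v. dz d s i v = 0) (nhds 0)"
    by (auto simp: has_fps_expansion_def elim: eventually_mono)
  then show ?thesis by (rule real_analytic_identity[OF dz_analytic])
qed

end

end

section \<open>Source and sink components\<close>

text \<open>Phrased with \<open>E\<close> itself, whose pairs point against the arcs; mutual
  reachability is insensitive to the direction, which lets sinks be treated as sources of the
  converse relation.\<close>

definition strong_component :: "'a set \<Rightarrow> ('a \<times> 'a) set \<Rightarrow> 'a set \<Rightarrow> bool" where
  "strong_component N E S \<longleftrightarrow> S \<noteq> {} \<and> S \<subseteq> N \<and> (\<forall>u\<in>S. \<forall>v\<in>S. (u, v) \<in> E\<^sup>*) \<and>
     (\<forall>u\<in>S. \<forall>v. (u, v) \<in> E\<^sup>* \<longrightarrow> (v, u) \<in> E\<^sup>* \<longrightarrow> v \<in> S)"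

lemma reachable_influence_graph:
  assumes "E \<subseteq> N \<times> N"
  shows "u \<rightarrow>\<^sup>*\<^bsub>influence_graph N E\<^esub> v \<longleftrightarrow> u \<in> N \<and> (v, u) \<in> E\<^sup>*"
proof -
  have ends: "arcs_ends (influence_graph N E) = E\<inverse>"
    unfolding arcs_ends_def arc_to_ends_def influence_graph_def by (auto simp: image_iff Bex_def)
  have "u \<in> N \<and> (v, u) \<in> E\<^sup>*" if "(u, v) \<in> rtrancl_on N (E\<inverse>)"
    using that
  proof (induction rule: rtrancl_on_induct)
    case (step y z)
    then show ?case using converse_rtrancl_into_rtrancl[of z y E u] by blast
  qed blast
  moreover have "(u, v) \<in> rtrancl_on N (E\<inverse>)" if "u \<in> N" "(v, u) \<in> E\<^sup>*"
    using that(2)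
  proof (induction rule: converse_rtrancl_induct)
    case base
    show ?case using that(1) by (rule rtrancl_on_refl)
  next
    case (step y z)
    then have "(z, y) \<in> E\<inverse>" "y \<in> N" using assms by blast+
    then show ?case using rtrancl_on_into_rtrancl_on[OF step.IH] by blast
  qed
  moreover have "verts (influence_graph N E) = N" by (simp add: influence_graph_def)
  ultimately show ?thesis
    unfolding reachable_def ends by metis
qed

lemma rtrancl_in_nodes: "(u, v) \<in> E\<^sup>* \<Longrightarrow> E \<subseteq> N \<times> N \<Longrightarrow> u \<in> N \<Longrightarrow> v \<in> N"
  by (induction rule: rtrancl_induct) auto

text \<open>Anything related to a node of \<open>N\<close> stays in \<open>N\<close>, so the
  membership conditions attached to each reachable pair amount to
  \<open>S \<subseteq> N\<close>.\<close>

lemma mutually_related_iff: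
  assumes closed: "\<And>u v. u \<in> N \<Longrightarrow> (u, v) \<in> r \<Longrightarrow> v \<in> N"
  shows "S \<noteq> {} \<and> (\<forall>u\<in>S. \<forall>v\<in>S. u \<in> N \<and> (v, u) \<in> r) \<and>
      (\<forall>u\<in>S. \<forall>v. v \<notin> S \<longrightarrow> \<not> (u \<in> N \<and> (v, u) \<in> r) \<or> \<not> (v \<in> N \<and> (u, v) \<in> r)) \<longleftrightarrow>
    S \<noteq> {} \<and> S \<subseteq> N \<and> (\<forall>u\<in>S. \<forall>v\<in>S. (u, v) \<in> r) \<and>
      (\<forall>u\<in>S. \<forall>v. (u, v) \<in> r \<longrightarrow> (v, u) \<in> r \<longrightarrow> v \<in> S)" (is "?L \<longleftrightarrow> ?R")
proof
  assume L: ?L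
  then have "S \<subseteq> N" by blast
  moreover have "v \<in> S" if "u \<in> S" "(u, v) \<in> r" "(v, u) \<in> r" for u v
  proof -
    have "u \<in> N" using \<open>S \<subseteq> N\<close> that(1) by blast
    then have "v \<in> N" using closed that(2) by blast
    then show ?thesis using L that \<open>u \<in> N\<close> by blast
  qed
  ultimately show ?R using L by blast
qed blast

lemma sccs_verts_influence_graph:
  assumes "E \<subseteq> N \<times> N"
  shows "pre_digraph.sccs_verts (influence_graph N E) = {S. strong_component N E S}"
  unfolding pre_digraph.sccs_verts_def reachable_influence_graph[OF assms] strong_component_def
  by (rule Collect_cong, rule mutually_related_iff) (rule rtrancl_in_nodes[OF _ assms])

lemma ex_strong_component:
  assumes "u \<in> N" "E \<subseteq> N \<times> N"
  shows "strong_component N E {w. (u, w) \<in> E\<^sup>* \<and> (w, u) \<in> E\<^sup>*}" (is "strong_component N E ?S")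
  unfolding strong_component_def
proof (intro conjI ballI allI impI)
  show "?S \<noteq> {}" using rtrancl_refl[of u E] by blast
  show "?S \<subseteq> N" using rtrancl_in_nodes[OF _ assms(2,1)] by (intro subsetI) simp
next
  fix v w assume "v \<in> ?S" "w \<in> ?S"
  then show "(v, w) \<in> E\<^sup>*" using rtrancl_trans[of v u E w] by simp
next
  fix v w assume v: "v \<in> ?S" and "(v, w) \<in> E\<^sup>*" "(w, v) \<in> E\<^sup>*"
  then show "w \<in> ?S" using rtrancl_trans[of u v E w] rtrancl_trans[of w v E u] by simp
qed

lemma strong_component_connected:
  assumes "strong_component N E S" "u \<in> S" "v \<in> S"
  shows "(u, v) \<in> E\<^sup>*"
proof -
  have "\<forall>u\<in>S. \<forall>v\<in>S. (u, v) \<in> E\<^sup>*"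
    using assms(1) unfolding strong_component_def by (elim conjE)
  from this[rule_format, OF assms(2,3)] show ?thesis .
qed

lemma strong_component_maximal:
  assumes "strong_component N E S" "u \<in> S" "(u, v) \<in> E\<^sup>*" "(v, u) \<in> E\<^sup>*"
  shows "v \<in> S"
proof -
  have "\<forall>u\<in>S. \<forall>v. (u, v) \<in> E\<^sup>* \<longrightarrow> (v, u) \<in> E\<^sup>* \<longrightarrow> v \<in> S"
    using assms(1) unfolding strong_component_def by (elim conjE)
  from this[rule_format, OF assms(2-4)] show ?thesis .
qed

lemma strong_component_nonempty: "strong_component N E S \<Longrightarrow> S \<noteq> {}"
  unfolding strong_component_def by (elim conjE)

lemma strong_component_subset: "strong_component N E S \<Longrightarrow> S \<subseteq> N"
  unfolding strong_component_def by (elim conjE)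

lemma strong_component_converse: "strong_component N (E\<inverse>) S \<longleftrightarrow> strong_component N E S"
proof -
  have "S \<noteq> {} \<and> S \<subseteq> N \<and> (\<forall>u\<in>S. \<forall>v\<in>S. (v, u) \<in> r) \<and> (\<forall>u\<in>S. \<forall>v. (v, u) \<in> r \<longrightarrow> (u, v) \<in> r \<longrightarrow> v \<in> S) \<longleftrightarrow>
    S \<noteq> {} \<and> S \<subseteq> N \<and> (\<forall>u\<in>S. \<forall>v\<in>S. (u, v) \<in> r) \<and> (\<forall>u\<in>S. \<forall>v. (u, v) \<in> r \<longrightarrow> (v, u) \<in> r \<longrightarrow> v \<in> S)"
    for r by blast
  then show ?thesis unfolding strong_component_def rtrancl_converse converse_iff .
qed

lemma strong_component_eq:
  assumes S: "strong_component N E S" and T: "strong_component N E T" and x: "x \<in> S" "x \<in> T"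
  shows "S = T"
proof (intro equalityI subsetI)
  fix y
  show "y \<in> T" if "y \<in> S"
    by (rule strong_component_maximal[OF T x(2)])
      (rule strong_component_connected[OF S x(1) that] strong_component_connected[OF S that x(1)])+
  show "y \<in> S" if "y \<in> T"
    by (rule strong_component_maximal[OF S x(1)])
      (rule strong_component_connected[OF T x(2) that] strong_component_connected[OF T that x(2)])+
qed

text \<open>A predecessor outside \<open>C\<close> would lie in a different component, which would
  then send an arc to \<open>C\<close> in the condensation.\<close>

lemma source_component_iff:
  assumes "E \<subseteq> N \<times> N"
  shows "source_component N E C \<longleftrightarrow> strong_component N E C \<and> (\<forall>i j. (i, j) \<in> E \<longrightarrow> i \<in> C \<longrightarrow> j \<in> C)"
    (is "_ \<longleftrightarrow> _ \<and> ?closed")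
proof -
  have "source_component N E C \<longleftrightarrow> strong_component N E C \<and>
      (\<forall>C'. strong_component N E C' \<longrightarrow> C \<noteq> C' \<longrightarrow> (\<forall>u\<in>C. \<forall>w\<in>C'. (u, w) \<notin> E))" (is "_ \<longleftrightarrow> _ \<and> ?noarc")
    unfolding source_component_def condensation_def sccs_verts_influence_graph[OF assms] Let_def
    by (auto simp: influence_graph_def in_arcs_def)
  moreover have "?noarc \<longleftrightarrow> ?closed" if C: "strong_component N E C"
  proof (intro iffI allI impI ballI)
    fix i j assume no: ?noarc and ij: "(i, j) \<in> E" "i \<in> C"
    have "j \<in> N" using ij assms by auto
    from no[rule_format, OF ex_strong_component[OF this assms] _ ij(2)] ij(1)
    have "C = {w. (j, w) \<in> E\<^sup>* \<and> (w, j) \<in> E\<^sup>*}" by (metis (no_types, lifting) mem_Collect_eq rtrancl_refl)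
    then show "j \<in> C" by simp
  next
    fix C' u w assume cl: ?closed and C': "strong_component N E C'" "C \<noteq> C'" and uw: "u \<in> C" "w \<in> C'"
    show "(u, w) \<notin> E"
    proof
      assume "(u, w) \<in> E"
      then have "w \<in> C" using cl uw by blast
      then show False using strong_component_eq[OF C C'(1) _ uw(2)] C'(2) by blast
    qed
  qed
  ultimately show ?thesis by blast
qed

lemma sink_component_iff:
  assumes "E \<subseteq> N \<times> N"
  shows "sink_component N E C \<longleftrightarrow> strong_component N E C \<and> (\<forall>i j. (i, j) \<in> E \<longrightarrow> j \<in> C \<longrightarrow> i \<in> C)"
    (is "_ \<longleftrightarrow> _ \<and> ?closed")
proof -
  have "sink_component N E C \<longleftrightarrow> strong_component N E C \<and>
      (\<forall>C'. strong_component N E C' \<longrightarrow> C' \<noteq> C \<longrightarrow> (\<forall>u\<in>C'. \<forall>w\<in>C. (u, w) \<notin> E))" (is "_ \<longleftrightarrow> _ \<and> ?noarc")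
    unfolding sink_component_def condensation_def sccs_verts_influence_graph[OF assms] Let_def
    by (auto simp: influence_graph_def out_arcs_def)
  moreover have "?noarc \<longleftrightarrow> ?closed" if C: "strong_component N E C"
  proof (intro iffI allI impI ballI)
    fix i j assume no: ?noarc and ij: "(i, j) \<in> E" "j \<in> C"
    have "i \<in> N" using ij assms by auto
    from no[rule_format, OF ex_strong_component[OF this assms] _ _ ij(2), of i] ij(1)
    have "C = {w. (i, w) \<in> E\<^sup>* \<and> (w, i) \<in> E\<^sup>*}" by (metis (no_types, lifting) mem_Collect_eq rtrancl_refl)
    then show "i \<in> C" by simp
  next
    fix C' u w assume cl: ?closed and C': "strong_component N E C'" "C' \<noteq> C" and uw: "u \<in> C'" "w \<in> C"
    show "(u, w) \<notin> E"
    proof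
      assume "(u, w) \<in> E"
      then have "u \<in> C" using cl uw by blast
      then show False using strong_component_eq[OF C C'(1) _ uw(1)] C'(2) by blast
    qed
  qed
  ultimately show ?thesis by blast
qed

text \<open>Among the ancestors of \<open>v\<close>, take one with the fewest ancestors: each
  predecessor of its component has the same ancestors, hence belongs to the component.\<close>

lemma ex_source_component:
  assumes "finite N" "E \<subseteq> N \<times> N" "v \<in> N"
  obtains C where "source_component N E C" "\<And>u. u \<in> C \<Longrightarrow> (v, u) \<in> E\<^sup>*"
proof -
  define anc where "anc = (\<lambda>u. {w. (u, w) \<in> E\<^sup>*})"
  have fin: "finite (anc u)" if "u \<in> N" for u
    using finite_subset[of "anc u" N] assms(1) rtrancl_in_nodes[OF _ assms(2) that] by (auto simp: anc_def)
  obtain u where u: "(v, u) \<in> E\<^sup>*" and min: "\<And>w. (v, w) \<in> E\<^sup>* \<Longrightarrow> card (anc u) \<le> card (anc w)"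
    using ex_has_least_nat[of "\<lambda>u. (v, u) \<in> E\<^sup>*" v "\<lambda>u. card (anc u)"] rtrancl_refl[of v E] by metis
  define C where "C = {w. (u, w) \<in> E\<^sup>* \<and> (w, u) \<in> E\<^sup>*}"
  have uN: "u \<in> N" using rtrancl_in_nodes[OF u assms(2,3)] .
  have "strong_component N E C" unfolding C_def by (rule ex_strong_component[OF uN assms(2)])
  moreover have "j \<in> C" if "(i, j) \<in> E" "i \<in> C" for i j
  proof -
    have uj: "(u, j) \<in> E\<^sup>*" using that rtrancl_into_rtrancl[of u i E j] by (simp add: C_def)
    then have "anc j \<subseteq> anc u" unfolding anc_def by (intro Collect_mono impI rtrancl_trans[OF uj])
    moreover have "card (anc u) \<le> card (anc j)" using min u uj by (meson rtrancl_trans)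
    ultimately have "anc j = anc u" using card_seteq[OF fin[OF uN]] by blast
    then have "u \<in> anc j" by (simp add: anc_def)
    then show ?thesis using uj by (simp add: anc_def C_def)
  qed
  ultimately have "source_component N E C" using source_component_iff[OF assms(2)] by metis
  moreover have "(v, w) \<in> E\<^sup>*" if "w \<in> C" for w
    using that rtrancl_trans[OF u, of w] by (simp add: C_def)
  ultimately show ?thesis using that by blast
qed

lemma sink_component_converse:
  assumes "E \<subseteq> N \<times> N"
  shows "sink_component N E C \<longleftrightarrow> source_component N (E\<inverse>) C"
proof -
  have "E\<inverse> \<subseteq> N \<times> N" using assms by auto
  then show ?thesis
    unfolding sink_component_iff[OF assms] source_component_iff[OF \<open>E\<inverse> \<subseteq> N \<times> N\<close>] strong_component_converse
    by blast
qed

section \<open>Necessity\<close>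

definition perturb :: "('a \<Rightarrow> 'a \<Rightarrow> real) \<Rightarrow> 'a \<Rightarrow> 'a \<Rightarrow> real \<Rightarrow> 'a \<Rightarrow> 'a \<Rightarrow> real" where
  "perturb W k l \<delta> = (\<lambda>i j. if i = k \<and> j = l then W i j + \<delta> else W i j)"

lemma matrix_dist_perturb:
  assumes "finite N"
  shows "matrix_dist N W (perturb W k l \<delta>) \<le> \<bar>\<delta>\<bar>"
proof -
  have "matrix_dist N W (perturb W k l \<delta>) \<le> (\<Sum>p\<in>N \<times> N. \<bar>(case p of (i, j) \<Rightarrow> W i j - perturb W k l \<delta> i j)\<bar>)"
    unfolding matrix_dist_def by (rule L2_set_le_sum_abs)
  also have "\<dots> \<le> (\<Sum>p\<in>N \<times> N. if p = (k, l) then \<bar>\<delta>\<bar> else 0)"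
    by (intro sum_mono) (auto simp: perturb_def split: if_splits)
  also have "\<dots> \<le> \<bar>\<delta>\<bar>" using assms by simp
  finally show ?thesis .
qed

lemma not_locally_identifiable:
  assumes "finite N" "consistent E W" "(k, l) \<in> E"
    and same: "\<And>\<delta> u t i. i \<in> Nm \<Longrightarrow> node_output N Ne f (perturb W k l \<delta>) u t i = node_output N Ne f W u t i"
  shows "\<not> locally_identifiable N E Ne Nm f W"
proof
  assume "locally_identifiable N E Ne Nm f W"
  then obtain t \<epsilon> where "\<epsilon> > 0" and *: "\<And>W'. consistent E W' \<Longrightarrow> matrix_dist N W W' < \<epsilon> \<Longrightarrow>
        (\<forall>i\<in>Nm. past_response N Ne f W t i = past_response N Ne f W' t i) \<Longrightarrow> W = W'"
    unfolding locally_identifiable_def by blast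
  let ?W' = "perturb W k l (\<epsilon> / 2)"
  have "W = ?W'"
  proof (rule *)
    show "consistent E ?W'" using assms(2,3) by (auto simp: consistent_def perturb_def)
    show "matrix_dist N W ?W' < \<epsilon>" using matrix_dist_perturb[OF assms(1), of W k l "\<epsilon>/2"] \<open>\<epsilon> > 0\<close> by simp
    show "\<forall>i\<in>Nm. past_response N Ne f W t i = past_response N Ne f ?W' t i"
      using same by (auto simp: past_response_def)
  qed
  then have "W k l = ?W' k l" by simp
  then show False using \<open>\<epsilon> > 0\<close> by (simp add: perturb_def)
qed

lemma not_identifiable_unexcited_source:
  assumes "finite N" "consistent E W" "(k, l) \<in> E" "l \<in> C" "f 0 = 0" "C \<inter> Ne = {}"
    and closed: "\<And>i j. (i, j) \<in> E \<Longrightarrow> i \<in> C \<Longrightarrow> j \<in> C"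
  shows "\<not> locally_identifiable N E Ne Nm f W"
proof (rule not_locally_identifiable[OF assms(1-3)])
  fix \<delta> u t i
  have zero: "i \<in> C \<Longrightarrow> node_output N Ne f W u t i = 0" for t i
  proof (induction t arbitrary: i)
    case (Suc t)
    have "W i j * node_output N Ne f W u t j = 0" for j
      using Suc closed[of i j] assms(2) by (cases "(i, j) \<in> E") (auto simp: consistent_def)
    then have "(\<Sum>j\<in>N. W i j * node_output N Ne f W u t j) = 0" by (intro sum.neutral) blast
    then show ?case using Suc.prems assms(5,6) by auto
  qed simp
  show "node_output N Ne f (perturb W k l \<delta>) u t i = node_output N Ne f W u t i"
  proof (induction t arbitrary: i)
    case (Suc t)
    have "perturb W k l \<delta> i j * node_output N Ne f W u t j = W i j * node_output N Ne f W u t j" for j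
      using zero[OF assms(4), of t] by (auto simp: perturb_def)
    then have "(\<Sum>j\<in>N. perturb W k l \<delta> i j * node_output N Ne f W u t j) =
        (\<Sum>j\<in>N. W i j * node_output N Ne f W u t j)" by (intro sum.cong refl)
    then show ?case by (simp add: Suc)
  qed simp
qed

lemma not_identifiable_unmeasured_sink:
  assumes "finite N" "consistent E W" "(k, l) \<in> E" "k \<in> C" "C \<inter> Nm = {}"
    and closed: "\<And>i j. (i, j) \<in> E \<Longrightarrow> j \<in> C \<Longrightarrow> i \<in> C"
  shows "\<not> locally_identifiable N E Ne Nm f W"
proof (rule not_locally_identifiable[OF assms(1-3)])
  fix \<delta> u t i assume "i \<in> Nm"
  have "i \<notin> C \<Longrightarrow> node_output N Ne f (perturb W k l \<delta>) u t i = node_output N Ne f W u t i" for t i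
  proof (induction t arbitrary: i)
    case (Suc t)
    have "perturb W k l \<delta> i j * node_output N Ne f (perturb W k l \<delta>) u t j =
        W i j * node_output N Ne f W u t j" for j
    proof (cases "(i, j) \<in> E")
      case True
      then have "j \<notin> C" using closed Suc.prems by blast
      then show ?thesis using Suc assms(4) by (auto simp: perturb_def)
    next
      case False
      then show ?thesis using assms(2,3) by (auto simp: consistent_def perturb_def)
    qed
    then show ?case by simp
  qed simp
  then show "node_output N Ne f (perturb W k l \<delta>) u t i = node_output N Ne f W u t i"
    using \<open>i \<in> Nm\<close> assms(5) by blast
qed

lemma weight_matrix_consistent: "consistent E (weight_matrix E w)"
  by (auto simp: consistent_def weight_matrix_def)

lemma edge_weights_weight_matrix: "w \<in> extensional E \<Longrightarrow> edge_weights E (weight_matrix E w) = w"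
  by (auto simp: edge_weights_def weight_matrix_def extensional_def restrict_def)

lemma weight_matrix_edge_weights: "consistent E W \<Longrightarrow> weight_matrix E (edge_weights E W) = W"
  by (intro ext) (auto simp: consistent_def edge_weights_def weight_matrix_def)

text \<open>Genericity would provide at least one \<open>f\<close> and one \<open>W\<close> outside
  the exceptional sets, and a single identifiable pair is already contradictory.\<close>

lemma not_generically_identifiable:
  assumes "finite E"
    and no: "\<And>f W. f \<in> class_FZ \<Longrightarrow> consistent E W \<Longrightarrow> \<not> locally_identifiable N E Ne Nm f W"
  shows "\<not> f_W_generically_locally_identifiable N E Ne Nm"
proof
  assume "f_W_generically_locally_identifiable N E Ne Nm"
  then obtain M Z where M: "M > 0" "lebesgue_null {1..M::nat} Z"
    and *: "\<And>f A. f \<in> class_FZ \<Longrightarrow> f has_fps_expansion A \<Longrightarrow> (\<lambda>k\<in>{1..M}. fps_nth A k) \<notin> Z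
      \<Longrightarrow> W_generically_locally_identifiable N E Ne Nm f"
    unfolding f_W_generically_locally_identifiable_def for_almost_all_FZ_def by blast
  obtain a where a: "a \<in> extensional {1..M}" "a \<notin> Z"
    using lebesgue_null_complement[OF _ M(2)] by blast
  \<comment> \<open>Any coefficient vector outside \<open>Z\<close> is realised by a polynomial
    without constant term, which belongs to the class.\<close>
  define p where "p = (\<Sum>k\<in>{1..M}. monom (a k) k)"
  have co: "coeff p k = (if k \<in> {1..M} then a k else 0)" for k
    by (simp add: p_def coeff_sum)
  have "poly p 0 = 0" using co[of 0] by (simp add: poly_0_coeff_0)
  then have FZ: "poly p \<in> class_FZ" by (simp add: class_FZ_def real_analytic_poly)
  have ex: "poly p has_fps_expansion fps_of_poly p"
    by (simp add: has_fps_expansion_def)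
  have "(\<lambda>k\<in>{1..M}. fps_nth (fps_of_poly p) k) = a"
    using a(1) by (auto simp: co extensional_def restrict_def)
  then have "W_generically_locally_identifiable N E Ne Nm (poly p)"
    using *[OF FZ ex] a(2) by simp
  then obtain Z' where Z': "lebesgue_null E Z'" "\<And>W. consistent E W \<Longrightarrow> edge_weights E W \<notin> Z' \<Longrightarrow>
      locally_identifiable N E Ne Nm (poly p) W"
    unfolding W_generically_locally_identifiable_def by blast
  obtain w where w: "w \<in> extensional E" "w \<notin> Z'"
    using lebesgue_null_complement[OF assms(1) Z'(1)] .
  then show False
    using Z'(2)[OF weight_matrix_consistent, of w] no[OF FZ weight_matrix_consistent]
    by (simp add: edge_weights_weight_matrix)
qed

lemma components_excited_and_measured:
  assumes "finite N" "E \<subseteq> N \<times> N" "\<forall>v. isolated_node N E v \<longrightarrow> v \<in> Ne \<and> v \<in> Nm"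
    and gen: "f_W_generically_locally_identifiable N E Ne Nm"
  shows "source_component N E C \<Longrightarrow> C \<inter> Ne \<noteq> {}" and "sink_component N E C \<Longrightarrow> C \<inter> Nm \<noteq> {}"
proof -
  have fE: "finite E" using assms(1,2) by (meson finite_SigmaI finite_subset)
  have isol: "isolated_node N E v" if "v \<in> N" "\<And>i. (i, v) \<notin> E" "\<And>j. (v, j) \<notin> E" for v
    using that by (auto simp: isolated_node_def influence_graph_def in_arcs_def out_arcs_def)
  show "C \<inter> Ne \<noteq> {}" if C: "source_component N E C"
  proof
    assume emp: "C \<inter> Ne = {}"
    from C have cl: "\<And>i j. (i, j) \<in> E \<Longrightarrow> i \<in> C \<Longrightarrow> j \<in> C" and "C \<noteq> {}" "C \<subseteq> N"
      using source_component_iff[OF assms(2)] strong_component_nonempty strong_component_subset by metis+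
    then obtain v where v: "v \<in> C" "v \<in> N" by auto
    then have "\<not> isolated_node N E v" using assms(3) emp by auto
    \<comment> \<open>An edge leaving \<open>v\<close> starts in \<open>C\<close> by choice of
      \<open>v\<close>; an edge entering \<open>v\<close> starts in \<open>C\<close> because
      \<open>C\<close> contains all its predecessors.\<close>
    then obtain k l where kl: "(k, l) \<in> E" "l \<in> C" using isol v cl by blast
    show False
      using not_generically_identifiable[OF fE, of N Ne Nm] gen
        not_identifiable_unexcited_source[OF assms(1) _ kl _ emp cl] by (auto simp: class_FZ_def)
  qed
  show "C \<inter> Nm \<noteq> {}" if C: "sink_component N E C"
  proof
    assume emp: "C \<inter> Nm = {}"
    from C have cl: "\<And>i j. (i, j) \<in> E \<Longrightarrow> j \<in> C \<Longrightarrow> i \<in> C" and "C \<noteq> {}" "C \<subseteq> N"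
      using sink_component_iff[OF assms(2)] strong_component_nonempty strong_component_subset by metis+
    then obtain v where v: "v \<in> C" "v \<in> N" by auto
    then have "\<not> isolated_node N E v" using assms(3) emp by auto
    then obtain k l where kl: "(k, l) \<in> E" "k \<in> C" using isol v cl by blast
    show False
      using not_generically_identifiable[OF fE, of N Ne Nm] gen
        not_identifiable_unmeasured_sink[OF assms(1) _ kl emp cl] by auto
  qed
qed

section \<open>Sufficiency\<close>

lemma ex_injective_weights:
  assumes "finite E"
  shows "\<exists>w :: 'b \<Rightarrow> real. (\<forall>q. w q \<ge> 1) \<and> inj_on w E"
proof -
  obtain h :: "'b \<Rightarrow> nat" and n where "inj_on h E" using finite_imp_inj_to_nat_seg[OF assms] by blast
  then show ?thesis by (intro exI[of _ "\<lambda>q. 1 + real (h q)"]) (auto simp: inj_on_def)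
qed

text \<open>A node is \<open>dead\<close> if direction \<open>d\<close> affects no response there.
  For an edge \<open>(k, l)\<close>, the sink condition gives a walk from \<open>k\<close> to a
  measured node, so deadness propagates back to \<open>k\<close>. The source condition gives a walk
  from an excited node to \<open>l\<close>; at its length \<open>s\<close>, the exponential of
  \<open>l\<close> appears in the derivative at \<open>k\<close> and isolates
  \<open>d (k, l)\<close>.\<close>

lemma sensitivities_independent:
  assumes N: "finite N" "E \<subseteq> N \<times> N" "Ne \<subseteq> N"
    and w: "\<And>q. w q \<ge> 1" "inj_on w E"
    and source: "\<And>C. source_component N E C \<Longrightarrow> C \<inter> Ne \<noteq> {}"
    and sink: "\<And>C. sink_component N E C \<Longrightarrow> C \<inter> Nm \<noteq> {}"
    and d: "\<And>p. p \<notin> E \<Longrightarrow> d p = 0"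
    and zero: "\<And>e i s. e \<in> Ne \<Longrightarrow> i \<in> Nm \<Longrightarrow> (\<Sum>p\<in>E. fps_const (d p) *
      sensitivity_fps N (fps_exp 1 - 1) (weight_matrix E w) (weight_matrix E w) e p s i) = 0"
  shows "d p = 0"
proof (cases "p \<in> E")
  case True
  obtain k l where kl: "(k, l) \<in> E" "p = (k, l)" using True by (cases p) auto
  have net: "exp_network N E (weight_matrix E w) e" if "e \<in> Ne" for e
  proof
    show "weight_matrix E w i k \<noteq> weight_matrix E w j k" if "(i, k) \<in> E" "(j, k) \<in> E" "i \<noteq> j" for i j k
      using w(2) that by (auto simp: weight_matrix_def inj_on_def)
  qed (use N w(1) that weight_matrix_consistent in \<open>auto simp: weight_matrix_def\<close>)
  define dead where "dead = (\<lambda>i. \<forall>e\<in>Ne. \<forall>s v. exp_network.dz N (weight_matrix E w) e d s i v = 0)"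
  have dead_Nm: "dead i" if "i \<in> Nm" for i
    unfolding dead_def using exp_network.dz_eq_0[OF net, of _ d] d zero that by blast
  have dead_step: "dead j" if "dead i" "(i, j) \<in> E" for i j
    unfolding dead_def
  proof (intro ballI allI)
    fix e s v assume e: "e \<in> Ne"
    show "exp_network.dz N (weight_matrix E w) e d s j v = 0"
    proof (cases "j \<in> exp_network.R E e s")
      case True
      have "exp_network.dz N (weight_matrix E w) e d (Suc s) i v = 0" for v
        using that e unfolding dead_def by blast
      from exp_network.dz_back(2)[OF net[OF e] d this True that(2)] show ?thesis by simp
    next
      case False
      then show ?thesis by (intro exp_network.dz_unreached[OF net[OF e] d]) auto
    qed
  qed
  have dead_star: "dead j" if "(i, j) \<in> E\<^sup>*" "dead i" for i j
    using that by (induction rule: rtrancl_induct) (auto intro: dead_step)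
  have kN: "k \<in> N" and lN: "l \<in> N" using kl N(2) by auto
  have "E\<inverse> \<subseteq> N \<times> N" using N(2) by auto
  from ex_source_component[OF N(1) this kN]
  obtain C where C: "source_component N (E\<inverse>) C" "\<And>u. u \<in> C \<Longrightarrow> (k, u) \<in> (E\<inverse>)\<^sup>*" by blast
  then obtain m where "m \<in> C" "m \<in> Nm" using sink sink_component_converse[OF N(2)] by blast
  then have "(m, k) \<in> E\<^sup>*" using C(2) by (simp add: rtrancl_converse)
  then have deadk: "dead k" using dead_star dead_Nm[OF \<open>m \<in> Nm\<close>] by blast
  from ex_source_component[OF N(1,2) lN]
  obtain C' where C': "source_component N E C'" "\<And>u. u \<in> C' \<Longrightarrow> (l, u) \<in> E\<^sup>*" by blast
  then obtain e where e: "e \<in> Ne" "(l, e) \<in> E\<^sup>*" using source by blast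
  from e(2) have "\<exists>s. l \<in> exp_network.R E e s"
  proof (induction rule: converse_rtrancl_induct)
    case base
    show ?case using exp_network.R.simps(1)[OF net[OF e(1)]] by blast
  next
    case (step y z)
    then show ?case using exp_network.R.simps(2)[OF net[OF e(1)]] by blast
  qed
  then obtain s where s: "l \<in> exp_network.R E e s" ..
  have "exp_network.dz N (weight_matrix E w) e d (Suc s) k v = 0" for v
    using deadk e unfolding dead_def by blast
  from exp_network.dz_back(1)[OF net[OF e(1)] d this s] show ?thesis by (simp add: kl)
qed (rule d)

text \<open>The two weight matrices get separate variables, since the exact difference formula
  involves both; the third group holds the Maclaurin coefficients.\<close>

definition param_weights' :: "('a \<times> 'a) set \<Rightarrow> (('a \<times> 'a) + ('a \<times> 'a) + nat \<Rightarrow> real) \<Rightarrow> 'a \<Rightarrow> 'a \<Rightarrow> real" where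
  "param_weights' E x = weight_matrix E (\<lambda>q. x (Inl q))"

definition param_weights :: "('a \<times> 'a) set \<Rightarrow> (('a \<times> 'a) + ('a \<times> 'a) + nat \<Rightarrow> real) \<Rightarrow> 'a \<Rightarrow> 'a \<Rightarrow> real" where
  "param_weights E x = weight_matrix E (\<lambda>q. x (Inr (Inl q)))"

definition param_series :: "(('a \<times> 'a) + ('a \<times> 'a) + nat \<Rightarrow> real) \<Rightarrow> real fps" where
  "param_series x = fps_of_coeffs (\<lambda>k. x (Inr (Inr k)))"

definition params :: "('a \<times> 'a) set \<Rightarrow> (('a \<times> 'a) + ('a \<times> 'a) + nat) set" where
  "params E = Inl ` E \<union> Inr ` Inl ` E \<union> Inr ` Inr ` {1..}"

lemma polyfun_sensitivity:
  "(\<lambda>x. fps_nth (sensitivity_fps N (param_series x) (param_weights' E x) (param_weights E x) e p s i) n)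
    \<in> polyfun (params E)"
proof -
  have series: "polyfun_fps (params E) param_series"
    unfolding polyfun_fps_def
  proof
    fix k
    show "(\<lambda>x. fps_nth (param_series x) k) \<in> polyfun (params E)"
    proof (cases "k = 0")
      case True
      then show ?thesis by (simp add: param_series_def fps_of_coeffs_def polyfun.const)
    next
      case False
      then have "Inr (Inr k) \<in> params E" by (simp add: params_def)
      from polyfun.coord[OF this] show ?thesis
        using False by (simp add: param_series_def fps_of_coeffs_def)
    qed
  qed
  have weights: "(\<lambda>x. param_weights E x i j) \<in> polyfun (params E)" for i j
  proof (cases "(i, j) \<in> E")
    case True
    then have "Inr (Inl (i, j)) \<in> params E" by (simp add: params_def)
    from polyfun.coord[OF this] show ?thesis
      using True by (simp add: param_weights_def weight_matrix_def)
  qed (simp add: param_weights_def weight_matrix_def polyfun.const)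
  have weights': "(\<lambda>x. param_weights' E x i j) \<in> polyfun (params E)" for i j
  proof (cases "(i, j) \<in> E")
    case True
    then have "Inl (i, j) \<in> params E" by (simp add: params_def)
    from polyfun.coord[OF this] show ?thesis
      using True by (simp add: param_weights'_def weight_matrix_def)
  qed (simp add: param_weights'_def weight_matrix_def polyfun.const)
  show ?thesis
    using polyfun_fps_sensitivity[OF series weights weights'] unfolding polyfun_fps_def by (rule spec)
qed

definition pack :: "('q \<Rightarrow> real) \<Rightarrow> ('q \<Rightarrow> real) \<Rightarrow> (nat \<Rightarrow> real) \<Rightarrow> 'q + 'q + nat \<Rightarrow> real" where
  "pack w' w a = case_sum w' (case_sum w a)"

lemma params_pack [simp]:
  "param_weights' E (pack w' w a) = weight_matrix E w'"
  "param_weights E (pack w' w a) = weight_matrix E w"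
  "param_series (pack w' w a) = fps_of_coeffs a"
  by (simp_all add: param_weights'_def param_weights_def param_series_def pack_def)

lemma matrix_dist_bound:
  assumes "finite N" "E \<subseteq> N \<times> N" "q \<in> E"
  shows "\<bar>edge_weights E W' q - edge_weights E W q\<bar> \<le> matrix_dist N W W'"
proof -
  obtain i j where q: "q = (i, j)" by (cases q)
  have "\<bar>W i j - W' i j\<bar> = \<bar>case (i, j) of (i, j) \<Rightarrow> W i j - W' i j\<bar>" by simp
  also have "\<dots> \<le> L2_set (\<lambda>p. \<bar>case p of (i, j) \<Rightarrow> W i j - W' i j\<bar>) (N \<times> N)"
    using assms q by (intro member_le_L2_set) auto
  also have "\<dots> = matrix_dist N W W'" by (simp add: matrix_dist_def L2_set_def)
  finally show ?thesis using assms(3) by (simp add: q edge_weights_def abs_minus_commute)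
qed

lemma generically_identifiable_if:
  assumes N: "finite N" "E \<subseteq> N \<times> N" "Ne \<subseteq> N"
    and source: "\<And>C. source_component N E C \<Longrightarrow> C \<inter> Ne \<noteq> {}"
    and sink: "\<And>C. sink_component N E C \<Longrightarrow> C \<inter> Nm \<noteq> {}"
  shows "f_W_generically_locally_identifiable N E Ne Nm"
proof -
  have fE: "finite E" using N(1,2) by (meson finite_SigmaI finite_subset)
  obtain w0 :: "'a \<times> 'a \<Rightarrow> real" where "\<forall>q. w0 q \<ge> 1" "inj_on w0 E"
    using ex_injective_weights[OF fE] by (elim exE conjE)
  then have w0: "\<And>q. w0 q \<ge> 1" "inj_on w0 E" by blast+
  define a0 where "a0 = fps_nth (fps_exp 1 - 1 :: real fps)"
  have A0: "fps_of_coeffs a0 = fps_exp 1 - 1"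
  proof (rule fps_ext)
    fix n
    show "fps_nth (fps_of_coeffs a0) n = fps_nth (fps_exp 1 - 1) n"
      by (cases "n = 0") (simp_all add: fps_of_coeffs_def a0_def)
  qed
  define h where "h = (\<lambda>p (e, i, s, n) x.
    fps_nth (sensitivity_fps N (param_series x) (param_weights' E x) (param_weights E x) e p s i) n)"
  define rows where "rows = Ne \<times> Nm \<times> (UNIV :: nat set) \<times> (UNIV :: nat set)"
  \<comment> \<open>Elimination at the point where both weight matrices are \<open>w0\<close> and
    the series is that of exp x - 1. A row is an excited node, a measured node, a delay and a power
    of the amplitude.\<close>
  have "\<exists>g\<in>polyfun (params E). \<exists>R0\<subseteq>rows. finite R0 \<and> g (pack w0 w0 a0) \<noteq> 0 \<and>
    (\<forall>x d. g x \<noteq> 0 \<longrightarrow> (\<forall>r\<in>R0. (\<Sum>p\<in>E. d p * h p r x) = 0) \<longrightarrow> (\<forall>p\<in>E. d p = 0))"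
  proof (rule polyfun_column_rank[where h = h and R = rows, OF fE])
    show "h p r \<in> polyfun (params E)" for p r
    proof -
      obtain e i s n where "r = (e, i, s, n)" by (cases r)
      then show ?thesis using polyfun_sensitivity[of N E e p s i n] by (simp add: h_def)
    qed
    fix d :: "'a \<times> 'a \<Rightarrow> real"
    assume z: "\<And>r. r \<in> rows \<Longrightarrow> (\<Sum>p\<in>E. d p * h p r (pack w0 w0 a0)) = 0"
    define d' where "d' = (\<lambda>p. if p \<in> E then d p else 0)"
    have "d' p = 0" for p
    proof (rule sensitivities_independent[where d = d' and w = w0, OF N])
      show "w0 q \<ge> 1" "inj_on w0 E" for q by (fact w0)+
      show "C \<inter> Ne \<noteq> {}" if "source_component N E C" for C using that by (rule source)
      show "C \<inter> Nm \<noteq> {}" if "sink_component N E C" for C using that by (rule sink)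
      show "d' p = 0" if "p \<notin> E" for p using that by (simp add: d'_def)
      fix e i s assume ei: "e \<in> Ne" "i \<in> Nm"
      show "(\<Sum>p\<in>E. fps_const (d' p) *
        sensitivity_fps N (fps_exp 1 - 1) (weight_matrix E w0) (weight_matrix E w0) e p s i) = 0"
      proof (rule fps_ext)
        fix n
        show "fps_nth (\<Sum>p\<in>E. fps_const (d' p) *
          sensitivity_fps N (fps_exp 1 - 1) (weight_matrix E w0) (weight_matrix E w0) e p s i) n = fps_nth 0 n"
        proof -
          have "(e, i, s, n) \<in> rows" using ei by (simp add: rows_def)
          have "fps_nth (\<Sum>p\<in>E. fps_const (d' p) * sensitivity_fps N (fps_exp 1 - 1)
              (weight_matrix E w0) (weight_matrix E w0) e p s i) n =
            (\<Sum>p\<in>E. d p * h p (e, i, s, n) (pack w0 w0 a0))"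
            unfolding fps_sum_nth by (rule sum.cong) (simp_all add: h_def A0 d'_def)
          then show ?thesis using z[OF \<open>(e, i, s, n) \<in> rows\<close>] by simp
        qed
      qed
    qed
    moreover have "d' p = d p" if "p \<in> E" for p using that by (simp add: d'_def)
    ultimately show "\<forall>p\<in>E. d p = 0" by auto
  qed
  then obtain g R0 where g: "g \<in> polyfun (params E)" and R0: "R0 \<subseteq> rows" "finite R0"
    and g0: "g (pack w0 w0 a0) \<noteq> 0"
    and inj: "\<forall>x d. g x \<noteq> 0 \<longrightarrow> (\<forall>r\<in>R0. (\<Sum>p\<in>E. d p * h p r x) = 0) \<longrightarrow> (\<forall>p\<in>E. d p = 0)"
    by (elim bexE exE conjE)
  obtain J where J: "finite J" "J \<subseteq> params E" "g \<in> polyfun J" using polyfun_finite_support[OF g] .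
  have "finite {k. Inr (Inr k) \<in> J}"
    using finite_vimageI[OF finite_vimageI[OF J(1), of Inr], of Inr] by (simp add: vimage_def)
  then obtain M where M: "\<And>k. Inr (Inr k) \<in> J \<Longrightarrow> k \<le> M"
    unfolding finite_nat_set_iff_bounded_le by auto
  have "finite ((\<lambda>r. fst (snd (snd r))) ` R0)" using R0(2) by simp
  then obtain T where T0: "\<forall>s\<in>(\<lambda>r. fst (snd (snd r))) ` R0. s \<le> T"
    unfolding finite_nat_set_iff_bounded_le by (elim exE)
  have T: "s \<le> T" if "(e, i, s, n) \<in> R0" for e i s n
    using bspec[OF T0 imageI[OF that]] by simp
  \<comment> \<open>The successor guarantees a positive number of coefficients even if
    \<open>g\<close> involves none.\<close>
  let ?M = "Suc M"
  \<comment> \<open>The weights are frozen at \<open>w0\<close> to get a condition on the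
    coefficients alone; \<open>a0\<close> witnesses that it is a proper one.\<close>
  define Z where "Z = {a \<in> extensional {1..?M}. g (pack w0 w0 a) = 0}"
  have Jcases: "(\<exists>q\<in>E. j = Inl q) \<or> (\<exists>q\<in>E. j = Inr (Inl q)) \<or> (\<exists>k\<in>{1..?M}. j = Inr (Inr k))" if "j \<in> J" for j
  proof -
    have "j \<in> params E" using J(2) that by blast
    then consider q where "q \<in> E" "j = Inl q" | q where "q \<in> E" "j = Inr (Inl q)"
      | k where "k \<ge> 1" "j = Inr (Inr k)" by (auto simp: params_def)
    then show ?thesis
    proof cases
      case (3 k)
      then have "k \<in> {1..?M}" using M[of k] that by simp
      then show ?thesis using 3 by blast
    qed blast+
  qed
  have poly_a: "(\<lambda>a. g (pack w0 w0 a)) \<in> polyfun {1..?M}"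
  proof (rule polyfun_subst[OF J(3)])
    show "(\<lambda>a. pack w0 w0 a j) \<in> polyfun {1..?M}" if "j \<in> J" for j
      using Jcases[OF that]
      by (elim disjE bexE) (simp_all add: pack_def polyfun.const polyfun.coord del: atLeastAtMost_iff)
  qed
  have nullZ: "lebesgue_null {1..?M} Z"
  proof -
    have "finite {1..?M}" by (rule finite_atLeastAtMost)
    from polyfun_zeros_lebesgue_null[where g = "\<lambda>a. g (pack w0 w0 a)", OF this poly_a, of a0] g0
    show ?thesis unfolding Z_def by fast
  qed
  have "W_generically_locally_identifiable N E Ne Nm f"
    if f: "f \<in> class_FZ" "f has_fps_expansion A" and nz: "(\<lambda>k\<in>{1..?M}. fps_nth A k) \<notin> Z" for f A
  proof -
    define a where "a = fps_nth A"
    have f0: "f 0 = 0" using f(1) by (simp add: class_FZ_def)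
    have "fps_nth A 0 = 0"
      using f(2) f0 by (auto simp: has_fps_expansion_def eval_fps_at_0 dest: eventually_nhds_x_imp_x)
    then have Aa: "fps_of_coeffs a = A" by (intro fps_ext) (simp add: fps_of_coeffs_def a_def)
    have "g (pack w0 w0 (\<lambda>k\<in>{1..?M}. fps_nth A k)) \<noteq> 0" using nz by (auto simp: Z_def)
    moreover have "g (pack w0 w0 (\<lambda>k\<in>{1..?M}. fps_nth A k)) = g (pack w0 w0 a)"
    proof (rule polyfun_cong[OF J(3)])
      show "pack w0 w0 (\<lambda>k\<in>{1..?M}. fps_nth A k) j = pack w0 w0 a j" if "j \<in> J" for j
        using Jcases[OF that] by (elim disjE bexE) (simp_all add: pack_def a_def)
    qed
    ultimately have ga: "g (pack w0 w0 a) \<noteq> 0" by simp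
    \<comment> \<open>Now the series is frozen and both weight matrices run along the diagonal;
      \<open>w0\<close> witnesses that the polynomial is nonzero there.\<close>
    define Z' where "Z' = {w \<in> extensional E. g (pack w w a) = 0}"
    have "(\<lambda>w. g (pack w w a)) \<in> polyfun E"
    proof (rule polyfun_subst[OF J(3)])
      show "(\<lambda>w. pack w w a j) \<in> polyfun E" if "j \<in> J" for j
        using Jcases[OF that] by (elim disjE bexE) (simp_all add: pack_def polyfun.const polyfun.coord)
    qed
    then have nullZ': "lebesgue_null E Z'"
      unfolding Z'_def using ga by (rule polyfun_zeros_lebesgue_null[OF fE])
    have "locally_identifiable N E Ne Nm f W" if W: "consistent E W" "edge_weights E W \<notin> Z'" for W
    proof -
      define w where "w = edge_weights E W"
      have gw: "g (pack w w a) \<noteq> 0"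
        using W(2) by (auto simp: Z'_def w_def edge_weights_def)
      \<comment> \<open>Leaving the diagonal: only the first matrix moves, and \<open>g\<close>
        stays nonzero nearby by continuity. Otherwise a sequence of matrices tending to
        \<open>W\<close> would contradict \<open>gw\<close>.\<close>
      have "\<exists>\<epsilon>>0. \<forall>W'. matrix_dist N W W' < \<epsilon> \<longrightarrow> g (pack (edge_weights E W') w a) \<noteq> 0"
      proof (rule ccontr)
        assume "\<not> ?thesis"
        then have none: "\<exists>W'. matrix_dist N W W' < \<epsilon> \<and> g (pack (edge_weights E W') w a) = 0" if "\<epsilon> > 0" for \<epsilon>
          using that by simp
        define V where "V = (\<lambda>n. SOME W'. matrix_dist N W W' < inverse (real (Suc n)) \<and>
          g (pack (edge_weights E W') w a) = 0)"
        have "matrix_dist N W (V n) < inverse (real (Suc n)) \<and> g (pack (edge_weights E (V n)) w a) = 0" for n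
        proof -
          have "0 < inverse (real (Suc n))" by simp
          from someI_ex[OF none[OF this]] show ?thesis unfolding V_def .
        qed
        then have V: "\<And>n. matrix_dist N W (V n) < inverse (real (Suc n))"
          "\<And>n. g (pack (edge_weights E (V n)) w a) = 0" by simp_all
        have "(\<lambda>n. edge_weights E (V n) q) \<longlonglongrightarrow> w q" if "q \<in> E" for q
        proof -
          have "(\<lambda>n. edge_weights E (V n) q - w q) \<longlonglongrightarrow> 0"
          proof (rule Lim_null_comparison[OF always_eventually LIMSEQ_inverse_real_of_nat], rule allI)
            fix n
            show "norm (edge_weights E (V n) q - w q) \<le> inverse (real (Suc n))"
              using matrix_dist_bound[OF N(1,2) that, of "V n" W] V(1)[of n] by (simp add: w_def)
          qed
          then show ?thesis by (simp add: LIM_zero_iff)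
        qed
        then have "(\<lambda>n. pack (edge_weights E (V n)) w a j) \<longlonglongrightarrow> pack w w a j" if "j \<in> J" for j
          using Jcases[OF that] by (auto simp: pack_def)
        then have "(\<lambda>n. g (pack (edge_weights E (V n)) w a)) \<longlonglongrightarrow> g (pack w w a)"
          by (rule polyfun_tendsto[OF J(3)])
        then have "(\<lambda>n. 0) \<longlonglongrightarrow> g (pack w w a)" using V(2) by simp
        then show False using gw by (simp add: LIMSEQ_const_iff)
      qed
      then obtain \<epsilon> where eps: "\<epsilon> > 0" "\<And>W'. matrix_dist N W W' < \<epsilon> \<Longrightarrow> g (pack (edge_weights E W') w a) \<noteq> 0"
        by blast
      show ?thesis unfolding locally_identifiable_def
      proof (intro exI[of _ "Suc T"] exI[of _ \<epsilon>] conjI allI impI)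
        fix W' assume W': "consistent E W'" "matrix_dist N W W' < \<epsilon>"
          and resp: "\<forall>i\<in>Nm. past_response N Ne f W (Suc T) i = past_response N Ne f W' (Suc T) i"
        have out: "node_output N Ne f W u (Suc T) i = node_output N Ne f W' u (Suc T) i" if "i \<in> Nm" for u i
          using fun_cong[OF bspec[OF resp that], of u] unfolding past_response_def by linarith
        \<comment> \<open>Giving the impulse at time \<open>T - s\<close> places the response with
          delay \<open>s\<close> at the one observed time \<open>Suc T\<close>.\<close>
        have imp: "impulse_fps N A W e s i = impulse_fps N A W' e s i" if "e \<in> Ne" "i \<in> Nm" "s \<le> T" for e i s
        proof -
          have "(\<lambda>x. node_output N Ne f W (impulse e (T - s) x) (Suc T) i) has_fps_expansion impulse_fps N A W e s i"
            using node_output_impulse_expansion[OF f(2) f0 that(1), of N W "T - s" s i] that(3)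
            by (simp del: node_output.simps)
          moreover have "(\<lambda>x. node_output N Ne f W (impulse e (T - s) x) (Suc T) i) has_fps_expansion impulse_fps N A W' e s i"
            using node_output_impulse_expansion[OF f(2) f0 that(1), of N W' "T - s" s i] that(3)
            by (simp add: out[OF that(2)] del: node_output.simps)
          ultimately show ?thesis by (rule has_fps_expansion_unique_real)
        qed
        let ?x = "pack (edge_weights E W') w a"
        define dd where "dd = (\<lambda>p. W' (fst p) (snd p) - W (fst p) (snd p))"
        \<comment> \<open>Equal responses make the left side of the difference formula zero, so
          \<open>dd\<close> satisfies each selected linear equation with coefficients taken at the
          pair \<open>W'\<close>, \<open>W\<close>.\<close>
        have rows0: "(\<Sum>p\<in>E. dd p * h p r ?x) = 0" if "r \<in> R0" for r
        proof -
          obtain e i s n where r: "r = (e, i, s, n)" by (cases r) auto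
          then have "e \<in> Ne" "i \<in> Nm" "s \<le> T" using that R0(1) T by (auto simp: rows_def)
          then have "(\<Sum>p\<in>E. fps_const (W' (fst p) (snd p) - W (fst p) (snd p)) * sensitivity_fps N A W' W e p s i) = 0"
            using impulse_fps_diff[OF N(1,2) W(1) W'(1), of A e s i] imp \<open>fps_nth A 0 = 0\<close> by simp
          then have "fps_nth (\<Sum>p\<in>E. fps_const (W' (fst p) (snd p) - W (fst p) (snd p)) * sensitivity_fps N A W' W e p s i) n = 0"
            by simp
          then show ?thesis
            by (simp add: r dd_def h_def Aa w_def weight_matrix_edge_weights W(1) W'(1) fps_sum_nth)
        qed
        have "g ?x \<noteq> 0" by (rule eps(2)[OF W'(2)])
        from inj[THEN spec[of _ ?x], THEN spec[of _ dd], THEN mp, OF this]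
        have "(\<forall>r\<in>R0. (\<Sum>p\<in>E. dd p * h p r ?x) = 0) \<longrightarrow> (\<forall>p\<in>E. dd p = 0)" .
        moreover have "\<forall>r\<in>R0. (\<Sum>p\<in>E. dd p * h p r ?x) = 0" by (intro ballI rows0)
        ultimately have dd0: "\<forall>p\<in>E. dd p = 0" by (rule mp)
        have eq: "W' (fst p) (snd p) = W (fst p) (snd p)" if "p \<in> E" for p
          using bspec[OF dd0 that] by (simp add: dd_def)
        show "W = W'"
        proof (intro ext)
          fix i j show "W i j = W' i j"
          proof (cases "(i, j) \<in> E")
            case True
            from eq[OF this] show ?thesis by simp
          next
            case False
            then have "W i j = 0" "W' i j = 0" using W(1) W'(1) unfolding consistent_def by metis+
            then show ?thesis by simp
          qed
        qed
      qed (use eps in auto)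
    qed
    then show ?thesis unfolding W_generically_locally_identifiable_def using nullZ' by blast
  qed
  then show ?thesis
    unfolding f_W_generically_locally_identifiable_def for_almost_all_FZ_def
    using nullZ by (intro exI[of _ ?M] conjI exI[of _ Z]) auto
qed

theorem theorem1:
  fixes N Ne Nm :: "'a set" and E :: "('a \<times> 'a) set"
  assumes "finite N" and "E \<subseteq> N \<times> N" and "Ne \<subseteq> N" and "Nm \<subseteq> N"
    and "\<forall>v. isolated_node N E v \<longrightarrow> v \<in> Ne \<and> v \<in> Nm"
  shows "f_W_generically_locally_identifiable N E Ne Nm \<longleftrightarrow>
    (\<forall>C. source_component N E C \<longrightarrow> C \<inter> Ne \<noteq> {}) \<and>
    (\<forall>C. sink_component N E C \<longrightarrow> C \<inter> Nm \<noteq> {})"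
  using components_excited_and_measured[OF assms(1,2,5)] generically_identifiable_if[OF assms(1-3)]
  by blast

end
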